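(* There exist a constant $c>0$, an integer $m_0$ and a polynomially bounded function $k=k(m)$ such that for every $m\ge m_0$ the following holds. Let $\mathcal V$ be the set of all valuations $v:2^{[m]}\to\mathbb R$ of precision $k(m)$ that are subadditive or single-minded. Then every deterministic truthful auction rule $\mathcal A:\mathcal V^3\to\Sigma\times\mathbb R^3$ for three bidders that guarantees a $\left(\frac{\sqrt3-1}{2}+\frac{12}{\log_2 m}\right)$-approximation to the optimal social welfare has communication complexity $$\mathrm{cc}(\mathcal A)\ \ge\ \exp\!\left(c\cdot\frac{\sqrt m}{\log_2 m}\right).$$
   Context: There are $m$ items $[m]=\{1,\dots,m\}$ and $n$ bidders (here $n=3$). A valuation is a function $v:2^{[m]}\to\mathbb R$ that is monotone ($v(S)\le v(T)$ for $S\subseteq T$) and normalized ($v(\emptyset)=0$). It has precision $k$ if all its values lie in $\{0\}\cup\{x/2^k : x\in\{1,\dots,2^{2k}\}\}$. It is subadditive if $v(S\cup T)\le v(S)+v(T)$ for all $S,T\subseteq[m]$. It is single-minded if there are $w\ge 0$ and $T\subseteq[m]$ with $v(S)=w$ when $S\supseteq T$ and $v(S)=0$ otherwise. $\Sigma$ is the set of allocations, i.e. tuples $(A_1,\dots,A_n)$ of pairwise disjoint subsets of $[m]$ (items may be left unallocated). An auction rule on $\mathcal V^n$ is a function $\mathcal A=(f,p_1,\dots,p_n):\mathcal V^n\to\Sigma\times\mathbb R^n$; $f_i$ is the bundle of bidder $i$ and $p_i$ her payment. It is truthful if for every $i$, all $v_i,v_i'\in\mathcal V$ and all $v_{-i}$: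 $v_i(f_i(v_i,v_{-i}))-p_i(v_i,v_{-i})\ge v_i(f_i(v_i',v_{-i}))-p_i(v_i',v_{-i})$. It guarantees an $\alpha$-approximation if for every profile $\sum_i v_i(f_i(v_1,\dots,v_n))\ge\alpha\cdot\max_{(S_1,\dots,S_n)\in\Sigma}\sum_i v_i(S_i)$. Communication is in the $n$-player deterministic number-in-hand blackboard model: player $i$ knows only $v_i$, all messages are visible to all players, and the transcript determines the output. The cost of a protocol is the maximum number of bits written; $\mathrm{cc}(\mathcal A)$ is the minimum cost of a protocol that computes $\mathcal A$ (both the allocation and the payments). *)

theory Defs
  imports Complex_Main "HOL-Library.FuncSet" "HOL-Library.Disjoint_Sets" "HOL-Library.Numeral_Type"
    "HOL-Library.Landau_Symbols" "HOL-Library.Extended_Real"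
begin

type_synonym valuation = "nat set \<Rightarrow> real"

abbreviation items :: "nat \<Rightarrow> nat set" where
  "items m \<equiv> {1..m}"

text \<open>Extensionality makes these functions correspond one-to-one to the functions on subsets of
  \<open>items m\<close>; otherwise a bidder's private input would also contain values at other sets.\<close>

definition valuations :: "nat \<Rightarrow> valuation set" where
  "valuations m = {v \<in> extensional (Pow (items m)). mono_on (Pow (items m)) v \<and> v {} = 0}"

definition has_precision :: "nat \<Rightarrow> nat \<Rightarrow> valuation \<Rightarrow> bool" where
  "has_precision m k v \<longleftrightarrow>
     (\<forall>S\<subseteq>items m. v S \<in> {0} \<union> {real x / 2 ^ k | x. x \<in> {1..2 ^ (2 * k)}})"

definition subadditive :: "nat \<Rightarrow> valuation \<Rightarrow> bool" where
  "subadditive m v \<longleftrightarrow> (\<forall>S\<subseteq>items m. \<forall>T\<subseteq>items m. v (S \<union> T) \<le> v S + v T)"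

definition single_minded :: "nat \<Rightarrow> valuation \<Rightarrow> bool" where
  "single_minded m v \<longleftrightarrow>
     (\<exists>w\<ge>0. \<exists>T\<subseteq>items m. \<forall>S\<subseteq>items m. v S = (if T \<subseteq> S then w else 0))"

definition subadditive_or_single_minded :: "nat \<Rightarrow> nat \<Rightarrow> valuation set" where
  "subadditive_or_single_minded m k =
     {v \<in> valuations m. has_precision m k v \<and> (subadditive m v \<or> single_minded m v)}"


text \<open>The bidders are the elements of a finite type \<open>'i\<close>.\<close>

type_synonym 'i profile = "'i \<Rightarrow> valuation"
type_synonym 'i allocation = "'i \<Rightarrow> nat set"
type_synonym 'i auction = "'i profile \<Rightarrow> 'i allocation \<times> ('i \<Rightarrow> real)"

definition profiles :: "valuation set \<Rightarrow> 'i profile set" where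
  "profiles V = UNIV \<rightarrow> V"

definition allocations :: "nat \<Rightarrow> 'i allocation set" where
  "allocations m = {S. (\<forall>i. S i \<subseteq> items m) \<and> disjoint_family S}"

definition auction_rules :: "nat \<Rightarrow> valuation set \<Rightarrow> 'i auction set" where
  "auction_rules m V = profiles V \<rightarrow> allocations m \<times> UNIV"

abbreviation won_items :: "'i auction \<Rightarrow> 'i \<Rightarrow> 'i profile \<Rightarrow> nat set" where
  "won_items \<A> i v \<equiv> fst (\<A> v) i"

abbreviation payment :: "'i auction \<Rightarrow> 'i \<Rightarrow> 'i profile \<Rightarrow> real" where
  "payment \<A> i v \<equiv> snd (\<A> v) i"

definition truthful :: "valuation set \<Rightarrow> 'i auction \<Rightarrow> bool" where
  "truthful V \<A> \<longleftrightarrow>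
     (\<forall>i. \<forall>v\<in>profiles V. \<forall>v'\<in>V.
        v i (won_items \<A> i v) - payment \<A> i v
          \<ge> v i (won_items \<A> i (v(i := v'))) - payment \<A> i (v(i := v')))"

definition welfare :: "'i::finite profile \<Rightarrow> 'i allocation \<Rightarrow> real" where
  "welfare v S = (\<Sum>i\<in>UNIV. v i (S i))"

definition guarantees_approx :: "nat \<Rightarrow> valuation set \<Rightarrow> real \<Rightarrow> 'i::finite auction \<Rightarrow> bool" where
  "guarantees_approx m V \<alpha> \<A> \<longleftrightarrow>
     (\<forall>v\<in>profiles V. welfare v (fst (\<A> v)) \<ge> \<alpha> * Max (welfare v ` allocations m))"


text \<open>Blackboard protocols as binary trees: a node of the tree is the current content of the
  blackboard. It determines the player who writes the next bit, and that bit is a function of the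
  player's own input \<open>'x\<close> only. A leaf carries the output.\<close>

datatype ('i, 'x, 'o) protocol =
    Output 'o
  | Speak 'i "'x \<Rightarrow> bool" "('i, 'x, 'o) protocol" "('i, 'x, 'o) protocol"

primrec transcript :: "('i, 'x, 'o) protocol \<Rightarrow> ('i \<Rightarrow> 'x) \<Rightarrow> bool list" where
  "transcript (Output z) x = []"
| "transcript (Speak i b P Q) x = b (x i) # (if b (x i) then transcript P x else transcript Q x)"

primrec outcome :: "('i, 'x, 'o) protocol \<Rightarrow> ('i \<Rightarrow> 'x) \<Rightarrow> 'o" where
  "outcome (Output z) x = z"
| "outcome (Speak i b P Q) x = (if b (x i) then outcome P x else outcome Q x)"

definition computes :: "('i \<Rightarrow> 'x) set \<Rightarrow> ('i, 'x, 'o) protocol \<Rightarrow> (('i \<Rightarrow> 'x) \<Rightarrow> 'o) \<Rightarrow> bool" where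
  "computes D P F \<longleftrightarrow> (\<forall>x\<in>D. outcome P x = F x)"

definition cost :: "('i \<Rightarrow> 'x) set \<Rightarrow> ('i, 'x, 'o) protocol \<Rightarrow> enat" where
  "cost D P = (SUP x\<in>D. enat (length (transcript P x)))"

text \<open>The infimum is a minimum whenever some protocol computes \<open>F\<close> on \<open>D\<close> (as is the case for
  finite \<open>D\<close>), and \<open>\<infinity>\<close> otherwise.\<close>

definition cc :: "('i \<Rightarrow> 'x) set \<Rightarrow> (('i \<Rightarrow> 'x) \<Rightarrow> 'o) \<Rightarrow> enat" where
  "cc D F = (INF P\<in>{P. computes D P F}. cost D P)"

end

theory Submission
  imports Defs "HOL-Analysis.Cartesian_Space" "HOL-Real_Asymp.Real_Asymp"
begin

text \<open>Take \<open>N\<close> sets \<open>A\<^sub>0, A\<^sub>1, \<dots>\<close> of items, with \<open>N = exp (\<Theta>(sqrt m / log m))\<close>, such that the items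
  realise every pattern on any \<open>3 h\<close> of them, where \<open>h = \<Theta>(log m)\<close>. A set \<open>f\<close> of indices yields a
  subadditive valuation \<open>\<phi> f\<close>, with values from \<open>0\<close> to \<open>2 h\<close>, for which \<open>A\<^sub>j\<close> is almost worthless if
  \<open>j \<notin> f\<close> and its complement is almost worthless if \<open>j \<in> f\<close>. Two bidders with the same \<open>\<phi> f\<close> have
  joint welfare at most \<open>2 h\<close>, whereas bidders with \<open>\<phi> f\<close> and \<open>\<phi> g\<close>, \<open>f \<noteq> g\<close>, can get almost \<open>4 h\<close>, and
  this even inside \<open>A\<^sub>j\<close> if \<open>j \<in> f \<inter> g\<close>.

  Give the third bidder a subadditive valuation that is a large constant plus the prices she faces on
  \<open>(\<phi> f, \<phi> f)\<close>. If the communication is small, then many \<open>f\<close> share the transcript, and for all \<open>f, g\<close>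
  among them her prices on \<open>(\<phi> f, \<phi> g)\<close> are at least those on the diagonal. Fix \<open>j\<close> such that
  many of these \<open>f\<close> contain \<open>j\<close> and many do not, and let \<open>T\<close> be the complement of \<open>A\<^sub>j\<close>. Two sets
  \<open>f \<noteq> g\<close> without \<open>j\<close> which share the transcript when the third bidder bids a lot for \<open>T\<close> have the
  same price of \<open>T\<close> on \<open>(\<phi> f, \<phi> f)\<close> and on \<open>(\<phi> f, \<phi> g)\<close>; on the latter the approximation guarantee
  forces it to be about \<open>4 h \<alpha>\<close>. So \<open>T\<close> costs about \<open>4 h \<alpha>\<close> everywhere, and a third bidder who
  bids slightly less for \<open>T\<close> loses. Now take \<open>f \<noteq> g\<close> containing \<open>j\<close> that share the transcript for
  this bid: on \<open>(\<phi> f, \<phi> g)\<close> or on \<open>(\<phi> g, \<phi> f)\<close> the auction reaches welfare at most \<open>2 h\<close>, although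
  about \<open>4 h + 4 h \<alpha>\<close> is possible. Hence \<open>2 \<alpha> (1 + \<alpha>) \<le> 1\<close> up to lower order terms, that is,
  \<open>\<alpha>\<close> is at most about \<open>(sqrt 3 - 1) / 2\<close>.\<close>

subsection \<open>Transcripts and counting\<close>

text \<open>Each bit depends on one player's input only, so the inputs that reach a fixed leaf form
  a combinatorial rectangle; the witness \<open>x\<close> may differ from coordinate to
  coordinate.\<close>

lemma transcript_rectangle:
  assumes "\<And>i. \<exists>x. transcript P x = t \<and> z i = x i"
  shows "transcript P z = t"
  using assms
proof (induction P arbitrary: t)
  case (Speak i b P Q)
  obtain s t' where t: "t = s # t'" "b (z i) = s"
    using Speak.prems[of i] by auto
  have "\<exists>x. transcript (if s then P else Q) x = t' \<and> z j = x j" for j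
    using Speak.prems[of j] t(1) by auto
  then show ?case
    using Speak.IH[of t'] t by (auto split: if_splits)
qed simp

lemma outcome_eq_of_transcript: "transcript P x = transcript P y \<Longrightarrow> outcome P x = outcome P y"
  by (induction P) (auto split: if_splits)

lemma finite_transcripts: "finite {t :: bool list. length t \<le> d}"
  using finite_lists_length_le[of "UNIV :: bool set" d] by simp

lemma card_transcripts: "card {t :: bool list. length t \<le> d} < 2 ^ Suc d"
proof -
  have "card {t :: bool list. length t \<le> d} = (\<Sum>i\<le>d. 2 ^ i)"
    using card_lists_length_le[of "UNIV :: bool set" d] by simp
  also have "\<dots> < 2 ^ Suc d"
    by (induction d) auto
  finally show ?thesis .
qed

lemma large_fibre:
  fixes t :: "'a \<Rightarrow> 'b"
  assumes "finite X" "finite T" "X \<noteq> {}" "t \<in> X \<rightarrow> T"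
  obtains y where "card X \<le> card {x \<in> X. t x = y} * card T"
proof -
  have "T \<noteq> {}" using assms by auto
  then obtain y where "card X \<le> card (t -` {y} \<inter> X) * card T"
    using pigeonhole_card[OF assms(4,1,2)] by blast
  moreover have "t -` {y} \<inter> X = {x \<in> X. t x = y}" by auto
  ultimately show ?thesis using that by metis
qed

lemma two_in_fibre:
  assumes "finite T" "t \<in> X \<rightarrow> T" "card T < card X"
  obtains x y where "x \<in> X" "y \<in> X" "x \<noteq> y" "t x = t y"
proof -
  have "card (t ` X) \<le> card T"
    using assms by (intro card_mono) auto
  then have "\<not> inj_on t X"
    using assms(3) by (intro pigeonhole) simp
  then show ?thesis
    using that unfolding inj_on_def by blast
qed

text \<open>If every index had a popular bit, then every member of the family would either be the string
  of all popular bits or be one of the few strings that deviate from it at some given index.\<close>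
lemma balanced_index:
  fixes F :: "nat set set"
  assumes "F \<subseteq> Pow {..<N}" "N * c + 1 < card F"
  obtains (balanced) j where "j < N" "c < card {f \<in> F. j \<in> f}" "c < card {f \<in> F. j \<notin> f}"
proof (rule ccontr)
  assume contra: "\<not> thesis"
  have fin: "finite F" using assms(1) by (rule finite_subset) simp
  define g where "g = {j. j < N \<and> card {f \<in> F. j \<notin> f} \<le> c}"
  define minority where "minority j = {f \<in> F. (j \<in> f) \<noteq> (j \<in> g)}" for j
  have "card (minority j) \<le> c" if "j < N" for j
  proof (cases "j \<in> g")
    case True
    then show ?thesis by (simp add: minority_def g_def)
  next
    case False
    then have "c < card {f \<in> F. j \<notin> f}" using that by (simp add: g_def)
    then have "card {f \<in> F. j \<in> f} \<le> c"
      using contra \<open>j < N\<close> balanced by (meson not_le)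
    then show ?thesis using False by (simp add: minority_def)
  qed
  moreover have "F \<subseteq> insert g (\<Union>j<N. minority j)"
  proof
    fix f assume "f \<in> F"
    show "f \<in> insert g (\<Union>j<N. minority j)"
    proof (cases "f = g")
      case False
      then obtain j where "(j \<in> f) \<noteq> (j \<in> g)" by blast
      moreover from this have "j < N"
        using assms(1) \<open>f \<in> F\<close> by (auto simp: g_def)
      ultimately show ?thesis using \<open>f \<in> F\<close> by (auto simp: minority_def)
    qed simp
  qed
  ultimately have "card F \<le> Suc (N * c)"
  proof -
    assume small: "\<And>j. j < N \<Longrightarrow> card (minority j) \<le> c"
      and cover: "F \<subseteq> insert g (\<Union>j<N. minority j)"
    have "card F \<le> card (insert g (\<Union>j<N. minority j))"
      using cover fin by (intro card_mono) (auto simp: minority_def)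
    also have "\<dots> \<le> Suc (card (\<Union>j<N. minority j))"
      by (simp add: card_insert_if fin minority_def)
    also have "card (\<Union>j<N. minority j) \<le> (\<Sum>j<N. card (minority j))"
      by (rule card_UN_le) simp
    also have "\<dots> \<le> (\<Sum>j<N. c)"
      using small by (intro sum_mono) simp
    finally show ?thesis by simp
  qed
  then show False using assms(2) by simp
qed

subsection \<open>Valuations from covering numbers\<close>

text \<open>Inserting \<open>h\<close> caps the covering number and also keeps the set nonempty when
  no cover exists.\<close>

definition capped_cover :: "nat \<Rightarrow> nat \<Rightarrow> (nat \<Rightarrow> 'a set) \<Rightarrow> 'a set \<Rightarrow> nat" where
  "capped_cover h N Z S = Min (insert h (card ` {I. I \<subseteq> {..<N} \<and> S \<subseteq> \<Union> (Z ` I)}))"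

lemma finite_covers [simp]: "finite {I. I \<subseteq> {..<N::nat} \<and> Q I}"
  by (rule finite_subset[of _ "Pow {..<N}"]) auto

lemma capped_cover_le: "capped_cover h N Z S \<le> h"
  by (simp add: capped_cover_def)

lemma capped_cover_le_card:
  "I \<subseteq> {..<N} \<Longrightarrow> S \<subseteq> \<Union> (Z ` I) \<Longrightarrow> capped_cover h N Z S \<le> card I"
  unfolding capped_cover_def by (intro Min_le) auto

lemma capped_cover_cases:
  obtains "capped_cover h N Z S = h"
  | I where "I \<subseteq> {..<N}" "S \<subseteq> \<Union> (Z ` I)" "capped_cover h N Z S = card I"
proof -
  have "capped_cover h N Z S \<in> insert h (card ` {I. I \<subseteq> {..<N} \<and> S \<subseteq> \<Union> (Z ` I)})"
    unfolding capped_cover_def by (rule Min_in) auto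
  then show ?thesis using that by auto
qed

lemma capped_cover_empty [simp]: "capped_cover h N Z {} = 0"
  using capped_cover_le_card[of "{}" N "{}" Z h] by simp

lemma capped_cover_mono: "S \<subseteq> T \<Longrightarrow> capped_cover h N Z S \<le> capped_cover h N Z T"
proof (rule capped_cover_cases[of h N Z T])
  fix I assume "S \<subseteq> T" "I \<subseteq> {..<N}" "T \<subseteq> \<Union> (Z ` I)" "capped_cover h N Z T = card I"
  then show ?thesis
    using capped_cover_le_card[of I N S Z h] by auto
qed (simp add: capped_cover_le)

lemma capped_cover_Un:
  "capped_cover h N Z (S \<union> T) \<le> capped_cover h N Z S + capped_cover h N Z T"
proof (rule capped_cover_cases[of h N Z S]; rule capped_cover_cases[of h N Z T])
  fix I J assume "I \<subseteq> {..<N}" "S \<subseteq> \<Union> (Z ` I)" and S: "capped_cover h N Z S = card I"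
    and "J \<subseteq> {..<N}" "T \<subseteq> \<Union> (Z ` J)" and T: "capped_cover h N Z T = card J"
  then have "capped_cover h N Z (S \<union> T) \<le> card (I \<union> J)"
    by (intro capped_cover_le_card) auto
  also have "\<dots> \<le> card I + card J" by (rule card_Un_le)
  finally show ?thesis by (simp add: S T)
qed (use capped_cover_le[of h N Z "S \<union> T"] in auto)

text \<open>Covers of \<open>S\<close>, of \<open>T\<close> and of the rest together cover
  \<open>M\<close> and so need \<open>3 * h\<close> indices; if the first two use fewer than
  \<open>h\<close> each, at least \<open>h\<close> are left for the rest.\<close>

lemma capped_cover_diff:
  assumes "\<And>I. I \<subseteq> {..<N} \<Longrightarrow> M \<subseteq> \<Union> (Z ` I) \<Longrightarrow> 3 * h \<le> card I"
    and "capped_cover h N Z S < h" "capped_cover h N Z T < h"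
  shows "capped_cover h N Z (M - (S \<union> T)) = h"
proof (rule capped_cover_cases[of h N Z S]; rule capped_cover_cases[of h N Z T];
    rule capped_cover_cases[of h N Z "M - (S \<union> T)"])
  fix I J L assume I: "I \<subseteq> {..<N}" "S \<subseteq> \<Union> (Z ` I)" "capped_cover h N Z S = card I"
    and J: "J \<subseteq> {..<N}" "T \<subseteq> \<Union> (Z ` J)" "capped_cover h N Z T = card J"
    and L: "L \<subseteq> {..<N}" "M - (S \<union> T) \<subseteq> \<Union> (Z ` L)"
       "capped_cover h N Z (M - (S \<union> T)) = card L"
  have "M \<subseteq> \<Union> (Z ` (I \<union> J \<union> L))"
    using I(2) J(2) L(2) by auto
  then have "3 * h \<le> card (I \<union> J \<union> L)"
    using assms(1) I(1) J(1) L(1) by simp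
  also have "\<dots> \<le> card I + card J + card L"
    by (meson add_le_mono1 card_Un_le order_trans)
  finally have "h \<le> card L"
    using assms(2,3) I(3) J(3) by linarith
  then show ?thesis
    using L(3) capped_cover_le[of h N Z "M - (S \<union> T)"] by linarith
qed (use assms(2,3) in auto)

text \<open>Symmetrising the covering number makes the values of a set and of its complement add up to
  \<open>2 * h\<close>, so that two bidders with the same valuation cannot gain from sharing the items.\<close>
definition cover_value :: "nat \<Rightarrow> nat \<Rightarrow> (nat \<Rightarrow> 'a set) \<Rightarrow> 'a set \<Rightarrow> 'a set \<Rightarrow> nat" where
  "cover_value h N Z M S = h + capped_cover h N Z S - capped_cover h N Z (M - S)"

lemma cover_value_eq:
  "int (cover_value h N Z M S) = int h + int (capped_cover h N Z S) - int (capped_cover h N Z (M - S))"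
  using capped_cover_le[of h N Z "M - S"] unfolding cover_value_def by simp

lemma cover_value_le: "cover_value h N Z M S \<le> 2 * h"
  using capped_cover_le[of h N Z S] unfolding cover_value_def by simp

lemma cover_value_mono:
  assumes "S \<subseteq> T"
  shows "cover_value h N Z M S \<le> cover_value h N Z M T"
proof -
  have "M - T \<subseteq> M - S" using assms by auto
  from capped_cover_mono[OF assms, of h N Z] capped_cover_mono[OF this, of h N Z] show ?thesis
    using cover_value_eq[of h N Z M S] cover_value_eq[of h N Z M T] by linarith
qed

text \<open>Each set lies in the complement of the other, so the covering number added for one is at
  most the one subtracted for the other.\<close>

lemma cover_value_disjoint:
  assumes "S \<inter> T = {}" "S \<subseteq> M" "T \<subseteq> M"
  shows "cover_value h N Z M S + cover_value h N Z M T \<le> 2 * h"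
proof -
  have "S \<subseteq> M - T" "T \<subseteq> M - S" using assms by auto
  from this[THEN capped_cover_mono[of _ _ h N Z]] show ?thesis
    using cover_value_eq[of h N Z M S] cover_value_eq[of h N Z M T] by linarith
qed

context
  fixes h N :: nat and Z :: "nat \<Rightarrow> 'a set" and M :: "'a set"
  assumes uncovered: "\<And>I. I \<subseteq> {..<N} \<Longrightarrow> M \<subseteq> \<Union> (Z ` I) \<Longrightarrow> 3 * h \<le> card I"
begin

lemma capped_cover_compl: "capped_cover h N Z S < h \<Longrightarrow> capped_cover h N Z (M - S) = h"
  using capped_cover_diff[OF uncovered, where S = S and T = S] by simp

lemma capped_cover_top: "capped_cover h N Z M = h"
  using capped_cover_compl[of "{}"] by (cases "h = 0") (use capped_cover_le[of h N Z M] in auto)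

lemma cover_value_empty: "cover_value h N Z M {} = 0"
  by (simp add: cover_value_def capped_cover_top)

text \<open>As \<open>S\<close> is cheap to cover, its complement is at the cap and its value is its
  covering number alone. If \<open>T\<close> is cheap too, the complement of the union is at the cap
  and subadditivity of covering suffices; otherwise \<open>M - T\<close> is covered through
  \<open>M - (S \<union> T)\<close> and \<open>S\<close>.\<close>

lemma cover_value_Un_aux:
  assumes small: "capped_cover h N Z S < h" and "S \<subseteq> M" "T \<subseteq> M"
  shows "cover_value h N Z M (S \<union> T) \<le> cover_value h N Z M S + cover_value h N Z M T"
proof -
  let ?a = "capped_cover h N Z"
  have compl: "?a (M - S) = h" using capped_cover_compl small by blast
  have "?a (S \<union> T) + ?a (M - T) \<le> ?a S + ?a T + ?a (M - (S \<union> T))"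
  proof (cases "?a T < h")
    case True
    then have "?a (M - (S \<union> T)) = h"
      using capped_cover_diff[OF uncovered] small by blast
    then show ?thesis
      using capped_cover_Un[of h N Z S T] capped_cover_le[of h N Z "M - T"] by linarith
  next
    case False
    have "?a (M - T) \<le> ?a ((M - (S \<union> T)) \<union> S)"
      by (intro capped_cover_mono) auto
    also have "\<dots> \<le> ?a (M - (S \<union> T)) + ?a S" by (rule capped_cover_Un)
    finally show ?thesis
      using False capped_cover_le[of h N Z "S \<union> T"] by linarith
  qed
  then show ?thesis
    using compl cover_value_eq[of h N Z M S] cover_value_eq[of h N Z M T]
      cover_value_eq[of h N Z M "S \<union> T"] by linarith
qed

text \<open>If neither set is below the cap, both values are at least \<open>h\<close> and their sum
  reaches the maximal value \<open>2 * h\<close>.\<close>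

lemma cover_value_Un:
  assumes "S \<subseteq> M" "T \<subseteq> M"
  shows "cover_value h N Z M (S \<union> T) \<le> cover_value h N Z M S + cover_value h N Z M T"
proof (cases "capped_cover h N Z S < h \<or> capped_cover h N Z T < h")
  case True
  then show ?thesis
    using cover_value_Un_aux[of S T] cover_value_Un_aux[of T S] assms
    by (auto simp: Un_commute add.commute)
next
  case False
  then have "capped_cover h N Z S = h" "capped_cover h N Z T = h"
    using capped_cover_le[of h N Z S] capped_cover_le[of h N Z T] by auto
  then show ?thesis
    using cover_value_le[of h N Z M "S \<union> T"] cover_value_eq[of h N Z M S]
      cover_value_eq[of h N Z M T] capped_cover_le[of h N Z "M - S"]
      capped_cover_le[of h N Z "M - T"] by linarith
qed

lemma cover_value_covered:
  assumes "I \<subseteq> {..<N}" "S \<subseteq> \<Union> (Z ` I)" "card I < h"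
  shows "cover_value h N Z M S \<le> card I"
  using capped_cover_le_card[OF assms(1,2), of h] assms(3) capped_cover_compl[of S]
    cover_value_eq[of h N Z M S] by linarith

lemma cover_value_co_covered:
  assumes "I \<subseteq> {..<N}" "M - S \<subseteq> \<Union> (Z ` I)" "card I < h" "S \<subseteq> M"
  shows "2 * h \<le> cover_value h N Z M S + card I"
proof -
  have "M - (M - S) = S" using assms(4) by auto
  then show ?thesis
    using capped_cover_le_card[OF assms(1,2), of h] assms(3) capped_cover_compl[of "M - S"]
      cover_value_eq[of h N Z M S] by auto
qed

end

subsection \<open>Universal families of sets\<close>

lemma card_prescribed_trace:
  assumes "J \<subseteq> I" "I \<subseteq> {..<N}"
  shows "card {c \<in> Pow {..<N}. c \<inter> I = J} = 2 ^ (N - card I)"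
proof -
  have "{c \<in> Pow {..<N}. c \<inter> I = J} = (\<lambda>d. J \<union> d) ` Pow ({..<N} - I)"
  proof (intro equalityI subsetI)
    fix c assume c: "c \<in> {c \<in> Pow {..<N}. c \<inter> I = J}"
    then have "c = J \<union> (c - I)" "c - I \<in> Pow ({..<N} - I)" by auto
    then show "c \<in> (\<lambda>d. J \<union> d) ` Pow ({..<N} - I)" by (rule image_eqI)
  qed (use assms in auto)
  moreover have "inj_on (\<lambda>d. J \<union> d) (Pow ({..<N} - I))"
    using assms(1) by (auto simp: inj_on_def)
  ultimately show ?thesis
    using assms(2) finite_subset[OF assms(2)]
    by (simp add: card_image card_Pow card_Diff_subset)
qed

text \<open>A random family works: a fixed pattern on \<open>t\<close> indices is missed by all \<open>m\<close> points with
  probability \<open>(1 - 1 / 2 ^ t) ^ m\<close>, and there are at most \<open>(2 * N) ^ t\<close> patterns.\<close>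
lemma universal_family:
  assumes "t \<le> N" and few: "real (2 * N) ^ t * (1 - 1 / 2 ^ t) ^ m < 1"
  obtains A :: "nat \<Rightarrow> nat set" where "\<And>i. A i \<subseteq> items m"
    and "\<And>I J. I \<subseteq> {..<N} \<Longrightarrow> card I \<le> t \<Longrightarrow> \<exists>x\<in>items m. \<forall>i\<in>I. x \<in> A i \<longleftrightarrow> i \<in> J"
proof -
  define Q where "Q = (SIGMA I:{I. I \<subseteq> {..<N} \<and> card I = t}. Pow I)"
  \<comment> \<open>A family is encoded by assigning to each item the set of indices
    \<open>i\<close> with the item in \<open>A i\<close>; \<open>bad (I, J)\<close> consists of the
    families in which no item has trace \<open>J\<close> on \<open>I\<close>.\<close>
  define bad where "bad = (\<lambda>(I, J). items m \<rightarrow>\<^sub>E {c \<in> Pow {..<N}. c \<inter> I \<noteq> J})"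
  have finQ: "finite Q"
    unfolding Q_def by (intro finite_SigmaI) (auto intro: finite_subset[of _ "{..<N}"])
  have "card Q = (\<Sum>I | I \<subseteq> {..<N} \<and> card I = t. card (Pow I))"
    unfolding Q_def by (intro card_SigmaI) (auto intro: finite_subset[of _ "{..<N}"])
  also have "\<dots> = (\<Sum>I | I \<subseteq> {..<N} \<and> card I = t. 2 ^ t)"
    by (intro sum.cong refl) (auto simp: card_Pow dest: finite_subset[of _ "{..<N}"])
  also have "\<dots> = (N choose t) * 2 ^ t"
    using n_subsets[of "{..<N}" t] by simp
  also have "\<dots> \<le> N ^ t * 2 ^ t"
    using binomial_le_pow[OF assms(1)] by simp
  finally have cardQ: "real (card Q) \<le> real (2 * N) ^ t"
    by (simp add: power_mult_distrib mult.commute flip: of_nat_power of_nat_mult)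
  have card_bad: "real (card (bad q)) = (2 ^ N * (1 - 1 / 2 ^ t)) ^ m" if "q \<in> Q" for q
  proof -
    obtain I J where q: "q = (I, J)" "I \<subseteq> {..<N}" "card I = t" "J \<subseteq> I"
      using \<open>q \<in> Q\<close> by (auto simp: Q_def)
    have "{c \<in> Pow {..<N}. c \<inter> I \<noteq> J} = Pow {..<N} - {c \<in> Pow {..<N}. c \<inter> I = J}" by auto
    then have "card {c \<in> Pow {..<N}. c \<inter> I \<noteq> J}
        = card (Pow {..<N}) - card {c \<in> Pow {..<N}. c \<inter> I = J}"
      by (simp only:) (rule card_Diff_subset, auto)
    then have "card {c \<in> Pow {..<N}. c \<inter> I \<noteq> J} = 2 ^ N - 2 ^ (N - t)"
      using card_prescribed_trace[of J I N] q by (simp only: card_Pow finite_lessThan card_lessThan)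
    then have "real (card {c \<in> Pow {..<N}. c \<inter> I \<noteq> J}) = 2 ^ N - 2 ^ (N - t)"
      by (simp add: of_nat_diff)
    also have "\<dots> = 2 ^ N * (1 - 1 / 2 ^ t)"
      using assms(1) by (simp add: power_diff right_diff_distrib)
    finally show ?thesis
      by (simp add: q(1) bad_def card_PiE)
  qed
  have "real (card (\<Union>q\<in>Q. bad q)) \<le> (\<Sum>q\<in>Q. real (card (bad q)))"
    using card_UN_le[OF finQ, of bad] by (simp flip: of_nat_sum)
  also have "\<dots> = real (card Q) * (2 ^ N * (1 - 1 / 2 ^ t)) ^ m"
    using card_bad by simp
  also have "\<dots> \<le> real (2 * N) ^ t * (2 ^ N * (1 - 1 / 2 ^ t)) ^ m"
    using cardQ by (intro mult_right_mono) auto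
  also have "\<dots> = (real (2 * N) ^ t * (1 - 1 / 2 ^ t) ^ m) * (2 ^ N) ^ m"
    by (simp add: power_mult_distrib)
  also have "\<dots> < 1 * (2 ^ N) ^ m"
    using few by (intro mult_strict_right_mono) auto
  also have "1 * (2 ^ N) ^ m = real (card (items m \<rightarrow>\<^sub>E Pow {..<N}))"
    by (simp add: card_PiE card_Pow)
  finally have "card (\<Union>q\<in>Q. bad q) < card (items m \<rightarrow>\<^sub>E Pow {..<N})"
    by (simp only: of_nat_less_iff)
  moreover have fin_bad: "finite (\<Union>q\<in>Q. bad q)"
    using finQ by (auto simp: bad_def intro!: finite_PiE)
  ultimately obtain g where g: "g \<in> items m \<rightarrow>\<^sub>E Pow {..<N}" "g \<notin> (\<Union>q\<in>Q. bad q)"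
    using card_mono[OF fin_bad] by (meson not_le subsetI)
  show ?thesis
  proof (rule that[of "\<lambda>i. {x \<in> items m. i \<in> g x}"])
    fix I J :: "nat set" assume I: "I \<subseteq> {..<N}" "card I \<le> t"
    obtain K where K: "I \<subseteq> K" "K \<subseteq> {..<N}" "card K = t"
      using exists_subset_between[of I t "{..<N}"] I assms(1) by auto
    then have "(K, J \<inter> K) \<in> Q" by (auto simp: Q_def)
    then have "g \<notin> bad (K, J \<inter> K)" using g(2) by blast
    then obtain x where "x \<in> items m" "g x \<inter> K = J \<inter> K"
      using g(1) by (fastforce simp: bad_def PiE_iff)
    then show "\<exists>x\<in>items m. \<forall>i\<in>I. x \<in> {x \<in> items m. i \<in> g x} \<longleftrightarrow> i \<in> J"
      using K(1) by blast
  qed auto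
qed

subsection \<open>Prices for the third bidder\<close>

definition triple :: "'a \<Rightarrow> 'a \<Rightarrow> 'a \<Rightarrow> 3 \<Rightarrow> 'a" where
  "triple a b c = (\<lambda>i. if i = 1 then a else if i = 2 then b else c)"

lemma triple_simps [simp]: "triple a b c 1 = a" "triple a b c 2 = b" "triple a b c 3 = c"
  by (simp_all add: triple_def)

lemma triple_upd [simp]: "(triple a b c)(3 := d) = triple a b d"
proof
  show "((triple a b c)(3 := d)) i = triple a b d i" for i
    using exhaust_3[of i] by (auto simp: triple_def)
qed

lemma triple_in_profiles: "a \<in> V \<Longrightarrow> b \<in> V \<Longrightarrow> c \<in> V \<Longrightarrow> triple a b c \<in> profiles V"
  by (simp add: profiles_def triple_def)

lemma welfare_triple: "welfare (triple a b c) S = a (S 1) + b (S 2) + c (S 3)"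
  by (simp add: welfare_def sum_3)

lemma triple_in_allocations:
  assumes "X \<subseteq> items m" "Y \<subseteq> items m" "Z \<subseteq> items m" "X \<inter> Y = {}" "X \<inter> Z = {}" "Y \<inter> Z = {}"
  shows "triple X Y Z \<in> allocations m"
  using assms by (auto simp: allocations_def disjoint_family_on_def forall_3 Int_commute)

lemma finite_allocations: "finite (allocations m :: 'i::finite allocation set)"
proof (rule finite_subset)
  show "allocations m \<subseteq> (UNIV :: 'i set) \<rightarrow>\<^sub>E Pow (items m)"
    by (auto simp: allocations_def PiE_iff)
qed (simp add: finite_PiE)

section \<open>Integer-valued bids of bounded precision\<close>

definition single_bid :: "nat \<Rightarrow> nat set \<Rightarrow> nat \<Rightarrow> valuation" where
  "single_bid m T w = restrict (\<lambda>S. if T \<subseteq> S then real w else 0) (Pow (items m))"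

lemma single_bid_apply [simp]:
  "S \<subseteq> items m \<Longrightarrow> single_bid m T w S = (if T \<subseteq> S then real w else 0)"
  by (simp add: single_bid_def)

lemma single_bid_zero [simp]: "S \<subseteq> items m \<Longrightarrow> single_bid m T 0 S = 0"
  by simp

text \<open>The numerator of \<open>n\<close> over \<open>2 ^ k\<close> is \<open>n * 2 ^ k\<close>,
  which stays in range for \<open>n\<close> up to \<open>2 ^ k\<close>; hence all valuations
  constructed below are integral.\<close>

lemma integral_has_precision:
  assumes "\<And>S. S \<subseteq> items m \<Longrightarrow> \<exists>n\<le>2 ^ k. v S = real n"
  shows "has_precision m k v"
  unfolding has_precision_def
proof (intro allI impI)
  fix S assume "S \<subseteq> items m"
  then obtain n where n: "n \<le> 2 ^ k" "v S = real n" using assms by blast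
  show "v S \<in> {0} \<union> {real x / 2 ^ k |x. x \<in> {1..2 ^ (2 * k)}}"
  proof (cases "n = 0")
    case False
    have "n * 2 ^ k \<le> 2 ^ k * 2 ^ k" using n(1) by simp
    then have "n * 2 ^ k \<in> {1..2 ^ (2 * k)}"
      using False by (simp add: mult_2 power_add)
    moreover have "v S = real (n * 2 ^ k) / 2 ^ k" using n(2) by simp
    ultimately show ?thesis by blast
  qed (simp add: n)
qed

lemma single_bid_in:
  assumes "T \<subseteq> items m" "T \<noteq> {} \<or> w = 0" "w \<le> 2 ^ k"
  shows "single_bid m T w \<in> subadditive_or_single_minded m k"
proof -
  have "single_bid m T w \<in> valuations m"
    using assms(2) by (auto simp: valuations_def single_bid_def mono_on_def)
  moreover have "has_precision m k (single_bid m T w)"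
    using assms(3) by (intro integral_has_precision) auto
  moreover have "single_minded m (single_bid m T w)"
    unfolding single_minded_def using assms(1)
    by (intro exI[of _ "real w"] exI[of _ T] conjI) auto
  ultimately show ?thesis by (simp add: subadditive_or_single_minded_def)
qed

lemma integral_subadditive_in:
  fixes v :: "nat set \<Rightarrow> nat"
  assumes "v {} = 0" "\<And>S T. S \<subseteq> T \<Longrightarrow> T \<subseteq> items m \<Longrightarrow> v S \<le> v T"
    and "\<And>S. S \<subseteq> items m \<Longrightarrow> v S \<le> 2 ^ k"
    and "\<And>S T. S \<subseteq> items m \<Longrightarrow> T \<subseteq> items m \<Longrightarrow> v (S \<union> T) \<le> v S + v T"
  shows "restrict (\<lambda>S. real (v S)) (Pow (items m)) \<in> subadditive_or_single_minded m k"
    (is "?v \<in> _")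
proof -
  have "?v \<in> valuations m"
    using assms(1,2) by (auto simp: valuations_def mono_on_def)
  moreover have "has_precision m k ?v"
    using assms(3) by (intro integral_has_precision) auto
  moreover have "subadditive m ?v"
    unfolding subadditive_def using assms(4) by (auto simp flip: of_nat_add)
  ultimately show ?thesis by (simp add: subadditive_or_single_minded_def)
qed

lemma valuation_mono:
  "v \<in> subadditive_or_single_minded m k \<Longrightarrow> S \<subseteq> T \<Longrightarrow> T \<subseteq> items m \<Longrightarrow> v S \<le> v T"
  unfolding subadditive_or_single_minded_def valuations_def
  by (auto simp: mono_on_def)

lemma valuation_nonneg:
  assumes "v \<in> subadditive_or_single_minded m k" "S \<subseteq> items m"
  shows "0 \<le> v S"
  using valuation_mono[OF assms(1) empty_subsetI assms(2)] assms(1)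
  by (simp add: subadditive_or_single_minded_def valuations_def)

lemma valuation_empty: "v \<in> subadditive_or_single_minded m k \<Longrightarrow> v {} = 0"
  by (simp add: subadditive_or_single_minded_def valuations_def)

section \<open>Menu prices from truthfulness and approximation\<close>

locale approx_auction =
  fixes m k :: nat and \<A> :: "3 auction" and \<alpha> :: real
  assumes rule: "\<A> \<in> auction_rules m (subadditive_or_single_minded m k)"
    and truth: "truthful (subadditive_or_single_minded m k) \<A>"
    and approx: "guarantees_approx m (subadditive_or_single_minded m k) \<alpha> \<A>"
    and \<alpha>_pos: "0 < \<alpha>"
begin

abbreviation V :: "valuation set" where "V \<equiv> subadditive_or_single_minded m k"

abbreviation won :: "valuation \<Rightarrow> valuation \<Rightarrow> valuation \<Rightarrow> nat set" where
  "won a b c \<equiv> won_items \<A> 3 (triple a b c)"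

abbreviation pay :: "valuation \<Rightarrow> valuation \<Rightarrow> valuation \<Rightarrow> real" where
  "pay a b c \<equiv> payment \<A> 3 (triple a b c)"

lemma outcome_feasible:
  assumes "a \<in> V" "b \<in> V" "c \<in> V"
  shows "won_items \<A> i (triple a b c) \<subseteq> items m"
    and "i \<noteq> j \<Longrightarrow> won_items \<A> i (triple a b c) \<inter> won_items \<A> j (triple a b c) = {}"
proof -
  have "fst (\<A> (triple a b c)) \<in> allocations m"
    using rule triple_in_profiles[OF assms] by (auto simp: auction_rules_def Pi_iff mem_Times_iff)
  then show "won_items \<A> i (triple a b c) \<subseteq> items m"
    "i \<noteq> j \<Longrightarrow> won_items \<A> i (triple a b c) \<inter> won_items \<A> j (triple a b c) = {}"
    by (auto simp: allocations_def disjoint_family_on_def)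
qed

lemma approx_ge:
  assumes "a \<in> V" "b \<in> V" "c \<in> V"
    and "X \<subseteq> items m" "Y \<subseteq> items m" "Z \<subseteq> items m" "X \<inter> Y = {}" "X \<inter> Z = {}" "Y \<inter> Z = {}"
  shows "\<alpha> * (a X + b Y + c Z) \<le> a (won_items \<A> 1 (triple a b c))
    + b (won_items \<A> 2 (triple a b c)) + c (won a b c)"
proof -
  have "welfare (triple a b c) (triple X Y Z) \<le> Max (welfare (triple a b c) ` allocations m)"
    using triple_in_allocations[OF assms(4-9)] finite_allocations by (intro Max_ge) auto
  then have "\<alpha> * (a X + b Y + c Z) \<le> \<alpha> * Max (welfare (triple a b c) ` allocations m)"
    using \<alpha>_pos by (simp add: welfare_triple)
  also have "\<dots> \<le> welfare (triple a b c) (fst (\<A> (triple a b c)))"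
    using approx triple_in_profiles[OF assms(1-3)] by (simp add: guarantees_approx_def)
  finally show ?thesis by (simp add: welfare_triple)
qed

lemma truthful_third:
  assumes "a \<in> V" "b \<in> V" "c \<in> V" "d \<in> V"
  shows "c (won a b d) - pay a b d \<le> c (won a b c) - pay a b c"
proof -
  have "\<forall>v\<in>profiles V. \<forall>v'\<in>V. v 3 (won_items \<A> 3 v) - payment \<A> 3 v
          \<ge> v 3 (won_items \<A> 3 (v(3 := v'))) - payment \<A> 3 (v(3 := v'))"
    using truth by (auto simp: truthful_def)
  from this[rule_format, OF triple_in_profiles[OF assms(1-3)] assms(4)] show ?thesis by simp
qed

text \<open>Truthfulness does not make a losing bidder pay \<open>0\<close>, so all prices have to be compared with the
  payment \<open>base a b\<close> for the zero valuation.\<close>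
definition base :: "valuation \<Rightarrow> valuation \<Rightarrow> real" where
  "base a b = pay a b (single_bid m (items m) 0)"

text \<open>The menu price of the taxation principle: once \<open>W\<close> is so large that this
  bid must win, it is the least payment with which any report wins a bundle containing
  \<open>T\<close>.\<close>

definition price :: "nat \<Rightarrow> valuation \<Rightarrow> valuation \<Rightarrow> nat set \<Rightarrow> real" where
  "price W a b T = pay a b (single_bid m T W)"

text \<open>Subtracting \<open>base\<close> brings the prices into the range from \<open>0\<close>
  to \<open>W\<close>, and the floor makes the values integral, as the precision requires.\<close>

definition markup :: "nat \<Rightarrow> valuation \<Rightarrow> valuation \<Rightarrow> valuation" where
  "markup W a b = restrict
     (\<lambda>S. real (if S = {} then 0 else W + nat \<lfloor>price W a b S - base a b\<rfloor>)) (Pow (items m))"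

lemma zero_in: "single_bid m (items m) 0 \<in> V"
  by (rule single_bid_in) auto

context
  fixes a b :: valuation and W :: nat
  assumes a: "a \<in> V" and b: "b \<in> V" and W_le: "2 * W \<le> 2 ^ k"
    and W_big: "a (items m) + b (items m) < \<alpha> * real W"
begin

lemma W_pos: "0 < W"
proof (rule ccontr)
  assume "\<not> 0 < W"
  then show False
    using W_big valuation_nonneg[OF a, of "items m"] valuation_nonneg[OF b, of "items m"] by simp
qed

lemma big_in: "T \<subseteq> items m \<Longrightarrow> T \<noteq> {} \<Longrightarrow> single_bid m T W \<in> V"
  using W_le by (intro single_bid_in) auto

text \<open>If the bid lost, the welfare would be at most what the first two bidders value all items
  at, which is below \<open>\<alpha> * W\<close>, although \<open>W\<close> is attainable.\<close>

lemma big_wins: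
  assumes T: "T \<subseteq> items m" "T \<noteq> {}"
  shows "T \<subseteq> won a b (single_bid m T W)"
proof (rule ccontr)
  let ?c = "single_bid m T W"
  assume "\<not> T \<subseteq> won a b ?c"
  then have "?c (won a b ?c) = 0"
    using outcome_feasible[OF a b big_in[OF T]] by simp
  moreover have "\<alpha> * (a {} + b {} + ?c T) \<le> a (won_items \<A> 1 (triple a b ?c))
    + b (won_items \<A> 2 (triple a b ?c)) + ?c (won a b ?c)"
    using T by (intro approx_ge a b big_in) auto
  moreover have "a (won_items \<A> 1 (triple a b ?c)) \<le> a (items m)"
    "b (won_items \<A> 2 (triple a b ?c)) \<le> b (items m)"
    by (intro valuation_mono[OF a _ order_refl] valuation_mono[OF b _ order_refl]
        outcome_feasible(1)[OF a b big_in[OF T]])+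
  ultimately show False
    using W_big T by (simp add: valuation_empty[OF a] valuation_empty[OF b])
qed

lemma utility_ge_price:
  assumes c: "c \<in> V" and T: "T \<subseteq> items m" "T \<noteq> {}"
  shows "c T - price W a b T \<le> c (won a b c) - pay a b c"
  using truthful_third[OF a b c big_in[OF T]]
    valuation_mono[OF c big_wins[OF T] outcome_feasible(1)[OF a b big_in[OF T]]]
  unfolding price_def by linarith

lemma utility_ge_base:
  assumes c: "c \<in> V"
  shows "- base a b \<le> c (won a b c) - pay a b c"
  using truthful_third[OF a b c zero_in]
    valuation_nonneg[OF c outcome_feasible(1)[OF a b zero_in, of 3]]
  unfolding base_def by linarith

lemma price_le_of_superset:
  assumes c: "c \<in> V" and T: "T \<subseteq> won a b c" "T \<noteq> {}"
  shows "price W a b T \<le> pay a b c"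
proof -
  have T': "T \<subseteq> items m" using T outcome_feasible(1)[OF a b c] by blast
  have "won a b c \<subseteq> items m" using outcome_feasible(1)[OF a b c] .
  then show ?thesis
    using truthful_third[OF a b big_in[OF T' T(2)] c] T(1)
      outcome_feasible(1)[OF a b big_in[OF T' T(2)], of 3] big_wins[OF T' T(2)]
    unfolding price_def by simp
qed

lemma pay_eq_price:
  assumes c: "c \<in> V" and "won a b c \<noteq> {}"
  shows "pay a b c = price W a b (won a b c)"
  using price_le_of_superset[OF c order_refl assms(2)]
    utility_ge_price[OF c outcome_feasible(1)[OF a b c] assms(2)] by linarith

lemma price_mono:
  assumes "S \<subseteq> T" "S \<noteq> {}" "T \<subseteq> items m"
  shows "price W a b S \<le> price W a b T"
proof -
  have "T \<noteq> {}" using assms by auto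
  then show ?thesis
    unfolding price_def[of _ _ _ T]
    using assms big_wins[of T] by (intro price_le_of_superset big_in) auto
qed

lemma base_le_pay: "c \<in> V \<Longrightarrow> base a b \<le> pay a b c"
  using truthful_third[OF a b zero_in, of c]
    single_bid_zero[OF outcome_feasible(1)[OF a b zero_in], of "items m" 3]
    single_bid_zero[OF outcome_feasible(1)[OF a b], of c "items m" 3]
  unfolding base_def by linarith

lemma price_bounds:
  assumes "T \<subseteq> items m" "T \<noteq> {}"
  shows "base a b \<le> price W a b T" "price W a b T \<le> base a b + real W"
  using base_le_pay[OF big_in[OF assms]] utility_ge_base[OF big_in[OF assms]]
    big_wins[OF assms] outcome_feasible(1)[OF a b big_in[OF assms], of 3]
  unfolding price_def by auto

text \<open>If \<open>T\<close> were cheaper than \<open>w\<close>, a bidder offering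
  \<open>w\<close> for it would win it and leave only \<open>items m - T\<close> to the others; by
  \<open>gain\<close> the welfare would then violate the approximation guarantee.\<close>

lemma price_lower_bound:
  assumes T: "T \<subseteq> items m" "T \<noteq> {}" and w: "w \<le> 2 ^ k"
    and XY: "X \<subseteq> items m" "Y \<subseteq> items m" "X \<inter> Y = {}"
    and gain: "real w + (a (items m - T) + b (items m - T)) < \<alpha> * (a X + b Y)"
  shows "real w \<le> price W a b T - base a b"
proof (rule ccontr)
  let ?c = "single_bid m T w"
  assume less: "\<not> real w \<le> price W a b T - base a b"
  have c: "?c \<in> V" using T w by (intro single_bid_in) auto
  have sub: "won a b ?c \<subseteq> items m" using outcome_feasible(1)[OF a b c] .
  have wins: "T \<subseteq> won a b ?c"
  proof (rule ccontr)
    assume "\<not> T \<subseteq> won a b ?c"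
    then have "?c (won a b ?c) - pay a b ?c \<le> - base a b"
      using base_le_pay[OF c] sub by simp
    then show False
      using utility_ge_price[OF c T] less T by simp
  qed
  have "won_items \<A> i (triple a b ?c) \<subseteq> items m - T" if "i \<noteq> 3" for i
    using outcome_feasible[OF a b c] that wins by blast
  then have "a (won_items \<A> 1 (triple a b ?c)) \<le> a (items m - T)"
    "b (won_items \<A> 2 (triple a b ?c)) \<le> b (items m - T)"
    by (intro valuation_mono[OF a _ Diff_subset] valuation_mono[OF b _ Diff_subset], simp)+
  moreover have "\<alpha> * (a X + b Y + ?c {}) \<le> a (won_items \<A> 1 (triple a b ?c))
    + b (won_items \<A> 2 (triple a b ?c)) + ?c (won a b ?c)"
    using XY by (intro approx_ge a b c) auto
  ultimately show False
    using gain wins sub T(2) by simp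
qed

text \<open>Winning would give less than \<open>- base a b\<close>, the utility that reporting the
  zero valuation secures.\<close>

lemma low_bid_loses:
  assumes T: "T \<subseteq> items m" "T \<noteq> {}" and "w \<le> 2 ^ k" "real w < price W a b T - base a b"
  shows "\<not> T \<subseteq> won a b (single_bid m T w)"
proof
  have c: "single_bid m T w \<in> V" using assms by (intro single_bid_in) auto
  assume wins: "T \<subseteq> won a b (single_bid m T w)"
  then show False
    using utility_ge_base[OF c] price_le_of_superset[OF c wins T(2)] assms(4)
      outcome_feasible(1)[OF a b c, of 3] by simp
qed

text \<open>The price part is at most \<open>W\<close>, so any union is worth at most
  \<open>2 * W\<close>, while two nonempty sets are worth at least \<open>W\<close> each. This gives
  subadditivity whatever the prices are.\<close>

lemma markup_in: "markup W a b \<in> V"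
proof -
  let ?p = "\<lambda>S. nat \<lfloor>price W a b S - base a b\<rfloor>"
  have p_le: "?p S \<le> W" if "S \<subseteq> items m" "S \<noteq> {}" for S
    using price_bounds[OF that] by linarith
  have p_mono: "?p S \<le> ?p T" if "S \<subseteq> T" "S \<noteq> {}" "T \<subseteq> items m" for S T
    using price_mono[OF that] by (intro nat_mono floor_mono) simp
  show ?thesis
    unfolding markup_def
  proof (rule integral_subadditive_in)
    fix S T assume "S \<subseteq> T" "T \<subseteq> items m"
    then show "(if S = {} then 0 else W + ?p S) \<le> (if T = {} then 0 else W + ?p T)"
      using p_mono[of S T] by auto
  next
    fix S assume "S \<subseteq> items m"
    then show "(if S = {} then 0 else W + ?p S) \<le> 2 ^ k"
      using p_le[of S] W_le by (cases "S = {}") auto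
  next
    fix S T assume "S \<subseteq> items m" "T \<subseteq> items m"
    then show "(if S \<union> T = {} then 0 else W + ?p (S \<union> T))
        \<le> (if S = {} then 0 else W + ?p S) + (if T = {} then 0 else W + ?p T)"
      using p_le[of "S \<union> T"] by (cases "S = {}"; cases "T = {}") auto
  qed simp
qed

text \<open>Obtaining all items yields more than \<open>W - 1 - base a b\<close>, the
  \<open>1\<close> being lost to the floor; winning nothing yields at most
  \<open>- base a b\<close>.\<close>

lemma markup_wins: "won a b (markup W a b) \<noteq> {}" if "0 < m"
proof
  assume "won a b (markup W a b) = {}"
  moreover have m: "items m \<noteq> {}" using that by simp
  ultimately have "markup W a b (items m) - price W a b (items m) \<le> - base a b"
    using utility_ge_price[OF markup_in subset_refl m] base_le_pay[OF markup_in]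
      valuation_empty[OF markup_in] by simp
  moreover have "markup W a b (items m) = real W + nat \<lfloor>price W a b (items m) - base a b\<rfloor>"
    using m by (simp add: markup_def)
  ultimately show False
    using W_pos price_bounds[OF subset_refl m] by linarith
qed

end

text \<open>Facing the prices that she sees on \<open>(a, b)\<close>, a bidder with valuation \<open>markup W a b\<close> is almost
  indifferent between all bundles. If she still makes the same choice on \<open>(c, d)\<close>, then no bundle
  is cheaper there, up to the rounding.\<close>
lemma price_transfer:
  assumes ab: "a \<in> V" "b \<in> V" "a (items m) + b (items m) < \<alpha> * real W"
    and cd: "c \<in> V" "d \<in> V" "c (items m) + d (items m) < \<alpha> * real W"
    and W: "2 * W \<le> 2 ^ k"
    and same: "\<A> (triple a b (markup W a b)) = \<A> (triple c d (markup W a b))"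
    and T: "T \<subseteq> items m" "T \<noteq> {}"
  shows "price W a b T - 1 \<le> price W c d T"
proof -
  let ?h = "markup W a b"
  let ?S = "won a b ?h"
  have h: "?h \<in> V" using ab W by (intro markup_in)
  have S: "?S \<noteq> {}" "?S \<subseteq> items m"
    using markup_wins[OF ab(1,2) W ab(3)] T outcome_feasible(1)[OF ab(1,2) h] by auto
  \<comment> \<open>The payment is part of the common outcome, so the bundle that she wins has the
    same price on both sides.\<close>
  have "price W a b ?S = price W c d ?S"
    using pay_eq_price[OF ab(1,2) W ab(3) h] pay_eq_price[OF cd(1,2) W cd(3) h] S same by simp
  moreover have "?h T - price W c d T \<le> ?h ?S - price W c d ?S"
    using utility_ge_price[OF cd(1,2) W cd(3) h T] pay_eq_price[OF cd(1,2) W cd(3) h] same S by simp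
  moreover have "?h R = real W + nat \<lfloor>price W a b R - base a b\<rfloor>" if "R \<subseteq> items m" "R \<noteq> {}" for R
    using that by (simp add: markup_def)
  moreover have "real (nat \<lfloor>price W a b R - base a b\<rfloor>) \<le> price W a b R - base a b"
    "price W a b R - base a b - 1 \<le> real (nat \<lfloor>price W a b R - base a b\<rfloor>)"
    if "R \<subseteq> items m" "R \<noteq> {}" for R
    using price_bounds(1)[OF ab(1,2) W ab(3) that] by linarith+
  ultimately show ?thesis
    using T S by (smt (verit, best))
qed

end

subsection \<open>The fooling argument\<close>

context approx_auction
begin

text \<open>Three profiles with transcript \<open>t\<close>, each sharing one coordinate with
  \<open>(a, b, c)\<close>, place \<open>(a, b, c)\<close> at the same leaf, whose output is read
  off at \<open>x\<close>.\<close>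

lemma same_leaf:
  assumes P: "computes (profiles V) P \<A>"
    and "a \<in> V" "b \<in> V" "c \<in> V" "x \<in> profiles V"
    and "transcript P x = t" "transcript P (triple a b' c') = t"
      "transcript P (triple a' b c'') = t" "transcript P (triple a'' b'' c) = t"
  shows "\<A> (triple a b c) = \<A> x"
proof -
  have "\<exists>x. transcript P x = t \<and> triple a b c i = x i" for i
    using exhaust_3[of i] assms(7-9) by (metis triple_simps)
  then have "transcript P (triple a b c) = transcript P x"
    using transcript_rectangle[of P t "triple a b c"] assms(6) by simp
  then have "outcome P (triple a b c) = outcome P x"
    by (rule outcome_eq_of_transcript)
  then show ?thesis
    using P triple_in_profiles[OF assms(2-4)] assms(5) by (simp add: computes_def)
qed

text \<open>This isolates what is needed of the hard valuations. \<open>low\<close>,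
  \<open>high\<close> and the first strict bound on \<open>w\<close> make the complement of
  \<open>D j\<close> expensive; \<open>high_in\<close> and the second one then contradict
  \<open>sym\<close>. \<open>large\<close> leaves enough index sets for all pigeonhole
  steps.\<close>

lemma no_cheap_protocol:
  fixes \<phi> :: "nat set \<Rightarrow> valuation" and D :: "nat \<Rightarrow> nat set"
  assumes P: "computes (profiles V) P \<A>"
    and len: "\<And>x. x \<in> profiles V \<Longrightarrow> length (transcript P x) \<le> d"
    and in_V: "\<And>f. \<phi> f \<in> V"
    and top: "\<And>f. \<phi> f (items m) \<le> 2 * real h"
    and sym: "\<And>f S T. S \<subseteq> items m \<Longrightarrow> T \<subseteq> items m \<Longrightarrow> S \<inter> T = {} \<Longrightarrow> \<phi> f S + \<phi> f T \<le> 2 * real h"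
    and D: "\<And>j. j < N \<Longrightarrow> D j \<subset> items m"
    and low: "\<And>f j. j < N \<Longrightarrow> j \<notin> f \<Longrightarrow> \<phi> f (D j) \<le> 1"
    and high: "\<And>f g. f \<subseteq> {..<N} \<Longrightarrow> g \<subseteq> {..<N} \<Longrightarrow> f \<noteq> g \<Longrightarrow>
      \<exists>X Y. X \<subseteq> items m \<and> Y \<subseteq> items m \<and> X \<inter> Y = {} \<and> 4 * real h - 2 \<le> \<phi> f X + \<phi> g Y"
    and high_in: "\<And>f g j. j < N \<Longrightarrow> j \<in> f \<Longrightarrow> j \<in> g \<Longrightarrow> f \<subseteq> {..<N} \<Longrightarrow> g \<subseteq> {..<N} \<Longrightarrow> f \<noteq> g \<Longrightarrow>
      \<exists>X Y. X \<subseteq> D j \<and> Y \<subseteq> D j \<and> X \<inter> Y = {} \<and> 4 * real h - 4 \<le> \<phi> f X + \<phi> g Y"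
    and W: "4 * real h < \<alpha> * real W" "2 * W \<le> 2 ^ k"
    and w: "w \<le> 2 ^ k" "2 \<le> w" "real w + 2 < \<alpha> * (4 * real h - 2)"
      "2 * real h < \<alpha> * (4 * real h - 6 + real w)"
    and large: "(N * 2 ^ Suc d + 1) * (2 ^ Suc d * 2 ^ Suc d) \<le> (2 :: nat) ^ N"
  shows False
proof -
  define Tr where "Tr = {t :: bool list. length t \<le> d}"
  have finTr: "finite Tr" and cardTr: "card Tr < 2 ^ Suc d"
    unfolding Tr_def by (rule finite_transcripts, rule card_transcripts)
  have Tr: "transcript P (triple a b c) \<in> Tr" if "a \<in> V" "b \<in> V" "c \<in> V" for a b c
    using len triple_in_profiles[OF that] by (simp add: Tr_def)
  have big: "\<phi> f (items m) + \<phi> g (items m) < \<alpha> * real W" for f g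
    using top[of f] top[of g] W(1) by linarith
  have mk_in: "markup W (\<phi> f) (\<phi> f) \<in> V" for f
    using in_V W(2) big by (intro markup_in)

  \<comment> \<open>The first transcript serves to transfer prices between profiles, the second to
    equalise the payments \<open>base\<close>.\<close>
  define \<tau> where "\<tau> f = (transcript P (triple (\<phi> f) (\<phi> f) (markup W (\<phi> f) (\<phi> f))),
      transcript P (triple (\<phi> f) (\<phi> f) (single_bid m (items m) 0)))" for f
  have "\<tau> \<in> Pow {..<N} \<rightarrow> Tr \<times> Tr"
    using Tr in_V mk_in zero_in by (auto simp: \<tau>_def)
  then obtain y where "card (Pow {..<N}) \<le> card {f \<in> Pow {..<N}. \<tau> f = y} * card (Tr \<times> Tr)"
    using large_fibre[of "Pow {..<N}" "Tr \<times> Tr" \<tau>] finTr by blast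
  moreover define F where "F = {f \<in> Pow {..<N}. \<tau> f = y}"
  ultimately have "2 ^ N \<le> card F * (card Tr * card Tr)"
    by (simp add: card_Pow card_cartesian_product)
  moreover have cardTr2: "card Tr * card Tr < 2 ^ Suc d * 2 ^ Suc d"
    using cardTr by (intro mult_strict_mono) auto
  ultimately have cardF: "N * 2 ^ Suc d + 1 < card F"
  proof (cases "card F = 0")
    case False
    assume "2 ^ N \<le> card F * (card Tr * card Tr)"
    also have "\<dots> < card F * (2 ^ Suc d * 2 ^ Suc d)"
      using False cardTr2 by (intro mult_strict_left_mono) auto
    finally have "(N * 2 ^ Suc d + 1) * (2 ^ Suc d * 2 ^ Suc d) < card F * (2 ^ Suc d * 2 ^ Suc d)"
      using large by (rule le_less_trans[rotated])
    then show ?thesis by (rule mult_less_cancel2[THEN iffD1, THEN conjunct2])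
  qed simp
  have F_sub: "F \<subseteq> Pow {..<N}" by (auto simp: F_def)

  \<comment> \<open>The diagonal profiles of \<open>e\<close>, \<open>f\<close> and
    \<open>g\<close>, each with its own markup, share the transcript \<open>fst y\<close> and supply
    the three coordinates of the mixed profile.\<close>
  have transfer: "price W (\<phi> e) (\<phi> e) T - 1 \<le> price W (\<phi> f) (\<phi> g) T"
    if "f \<in> F" "g \<in> F" "e \<in> F" "T \<subseteq> items m" "T \<noteq> {}" for e f g T
  proof (rule price_transfer[OF in_V in_V big in_V in_V big W(2) _ that(4,5)])
    show "\<A> (triple (\<phi> e) (\<phi> e) (markup W (\<phi> e) (\<phi> e)))
        = \<A> (triple (\<phi> f) (\<phi> g) (markup W (\<phi> e) (\<phi> e)))"
      using that
      by (intro same_leaf[OF P, where t = "fst y", symmetric] in_V mk_in triple_in_profiles)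
        (auto simp: F_def \<tau>_def)
  qed
  have base_eq: "base (\<phi> f) (\<phi> g) = base (\<phi> e) (\<phi> e)" if "f \<in> F" "g \<in> F" "e \<in> F" for e f g
  proof -
    have "\<A> (triple (\<phi> f) (\<phi> g) (single_bid m (items m) 0))
        = \<A> (triple (\<phi> e) (\<phi> e) (single_bid m (items m) 0))"
      using that by (intro same_leaf[OF P, where t = "snd y"] in_V zero_in triple_in_profiles)
        (auto simp: F_def \<tau>_def)
    then show ?thesis by (simp add: base_def)
  qed

  obtain j where j: "j < N" "2 ^ Suc d < card {f \<in> F. j \<in> f}" "2 ^ Suc d < card {f \<in> F. j \<notin> f}"
    using balanced_index[OF F_sub cardF] by blast
  define T where "T = items m - D j"
  have T: "T \<subseteq> items m" "T \<noteq> {}" and DT: "items m - T = D j" and D_sub: "D j \<subseteq> items m"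
    using D[OF j(1)] by (auto simp: T_def)

  have bid_in: "single_bid m T u \<in> V" if "u \<le> 2 ^ k" for u
    using T that by (intro single_bid_in) auto
  have W_le: "W \<le> 2 ^ k" using W(2) by simp

  text \<open>Two members of the family without \<open>j\<close> certify that \<open>T\<close> is expensive.\<close>
  obtain f g where fg: "f \<in> F" "g \<in> F" "j \<notin> f" "j \<notin> g" "f \<noteq> g"
    and leaf: "transcript P (triple (\<phi> f) (\<phi> f) (single_bid m T W))
      = transcript P (triple (\<phi> g) (\<phi> g) (single_bid m T W))"
  proof (rule two_in_fibre[of Tr "\<lambda>f. transcript P (triple (\<phi> f) (\<phi> f) (single_bid m T W))"
        "{f \<in> F. j \<notin> f}"])
    show "card Tr < card {f \<in> F. j \<notin> f}" using cardTr j(3) by linarith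
  qed (use finTr Tr in_V bid_in[OF W_le] in auto)
  have "\<A> (triple (\<phi> f) (\<phi> g) (single_bid m T W)) = \<A> (triple (\<phi> f) (\<phi> f) (single_bid m T W))"
    using leaf by (intro same_leaf[OF P, OF _ _ _ _ refl] in_V bid_in W_le triple_in_profiles) auto
  then have "price W (\<phi> f) (\<phi> g) T = price W (\<phi> f) (\<phi> f) T"
    by (simp add: price_def)
  \<comment> \<open>If the third bidder gets \<open>T\<close>, the others share \<open>D j\<close>,
    worth at most \<open>1\<close> to each of them; hence the \<open>+ 2\<close> in the first bound
    on \<open>w\<close>.\<close>
  moreover have "real w \<le> price W (\<phi> f) (\<phi> g) T - base (\<phi> f) (\<phi> g)"
  proof -
    obtain X Y where XY: "X \<subseteq> items m" "Y \<subseteq> items m" "X \<inter> Y = {}"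
      and "4 * real h - 2 \<le> \<phi> f X + \<phi> g Y"
      using high[OF _ _ fg(5)] fg(1,2) F_sub by blast
    then have "\<alpha> * (4 * real h - 2) \<le> \<alpha> * (\<phi> f X + \<phi> g Y)"
      using \<alpha>_pos by simp
    then show ?thesis
      using w(3) low[OF j(1) fg(3)] low[OF j(1) fg(4)]
      by (intro price_lower_bound[OF in_V in_V W(2) big T w(1) XY], unfold DT) linarith
  qed
  \<comment> \<open>The rounding in \<open>transfer\<close> costs \<open>1\<close>; the bid
    \<open>w - 2\<close> used next is therefore strictly below the price.\<close>
  ultimately have expensive: "real w - 1 \<le> price W (\<phi> a) (\<phi> b) T - base (\<phi> a) (\<phi> b)"
    if "a \<in> F" "b \<in> F" for a b
    using transfer[OF that fg(1) T] base_eq[OF that fg(1)] base_eq[OF fg(1,2,1)] by linarith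

  text \<open>Hence the third bidder loses, although the first two could share the remaining items.\<close>
  let ?c = "single_bid m T (w - 2)"
  have c: "?c \<in> V" using w(1) by (intro bid_in) simp
  obtain f g where fg: "f \<in> F" "g \<in> F" "j \<in> f" "j \<in> g" "f \<noteq> g"
    and leaf: "transcript P (triple (\<phi> f) (\<phi> f) ?c) = transcript P (triple (\<phi> g) (\<phi> g) ?c)"
  proof (rule two_in_fibre[of Tr "\<lambda>f. transcript P (triple (\<phi> f) (\<phi> f) ?c)" "{f \<in> F. j \<in> f}"])
    show "card Tr < card {f \<in> F. j \<in> f}" using cardTr j(2) by linarith
  qed (use finTr Tr in_V c in auto)
  have leaf_eq: "\<A> (triple (\<phi> a) (\<phi> b) ?c) = \<A> (triple (\<phi> f) (\<phi> f) ?c)"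
    if "a \<in> {f, g}" "b \<in> {f, g}" for a b
    using leaf that
    by (intro same_leaf[OF P, where b' = "\<phi> a" and a' = "\<phi> b" and a'' = "\<phi> f" and b'' = "\<phi> f"
          and c' = ?c and c'' = ?c and t = "transcript P (triple (\<phi> f) (\<phi> f) ?c)"]
        in_V c triple_in_profiles) auto
  define S where "S = fst (\<A> (triple (\<phi> f) (\<phi> f) ?c))"
  have S: "S 1 \<subseteq> items m" "S 2 \<subseteq> items m" "S 3 \<subseteq> items m" "S 1 \<inter> S 2 = {}"
    using outcome_feasible[OF in_V[of f] in_V[of f] c] by (auto simp: S_def)
  have welfare: "2 * real h < \<phi> a (S 1) + \<phi> b (S 2)"
    if ab: "a = f \<and> b = g \<or> a = g \<and> b = f" for a b
  proof -
    have out: "fst (\<A> (triple (\<phi> a) (\<phi> b) ?c)) = S"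
      using leaf_eq[of a b] ab by (auto simp: S_def)
    have "a \<noteq> b" "j \<in> a" "j \<in> b" "a \<in> F" "b \<in> F" using ab fg by auto
    then obtain X Y where XY: "X \<subseteq> D j" "Y \<subseteq> D j" "X \<inter> Y = {}"
      and "4 * real h - 4 \<le> \<phi> a X + \<phi> b Y"
      using high_in[OF j(1), of a b] F_sub by blast
    moreover have "\<not> T \<subseteq> S 3"
      using low_bid_loses[OF in_V[of a] in_V[of b] W(2) big T, of "w - 2"] w(1,2) out
        expensive[OF \<open>a \<in> F\<close> \<open>b \<in> F\<close>] by (simp add: of_nat_diff)
    moreover have "\<alpha> * (\<phi> a X + \<phi> b Y + ?c T) \<le> \<phi> a (S 1) + \<phi> b (S 2) + ?c (S 3)"
      using approx_ge[OF in_V[of a] in_V[of b] c, of X Y T] XY D_sub T(1) out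
      by (auto simp: T_def)
    ultimately have "\<alpha> * (\<phi> a X + \<phi> b Y + (real w - 2)) \<le> \<phi> a (S 1) + \<phi> b (S 2)"
      "\<alpha> * (4 * real h - 6 + real w) \<le> \<alpha> * (\<phi> a X + \<phi> b Y + (real w - 2))"
      using S(3) T(1) w(2) \<alpha>_pos by (simp_all add: of_nat_diff)
    then show ?thesis using w(4) by linarith
  qed
  \<comment> \<open>Both orders of \<open>f\<close> and \<open>g\<close> receive the same
    \<open>S\<close>, so the two welfare bounds add up to more than \<open>4 * h\<close>; regrouped
    by valuation, the same sum is at most \<open>4 * h\<close>.\<close>
  have "\<phi> f (S 1) + \<phi> f (S 2) \<le> 2 * real h" "\<phi> g (S 1) + \<phi> g (S 2) \<le> 2 * real h"
    using sym S by blast+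
  then show False
    using welfare[of f g] welfare[of g f] by simp
qed

end

subsection \<open>The hard instances and the choice of parameters\<close>

text \<open>This is the side of the split at \<open>i\<close> that is almost worthless for the
  valuation with index set \<open>f\<close>.\<close>

definition oriented :: "nat \<Rightarrow> (nat \<Rightarrow> nat set) \<Rightarrow> nat set \<Rightarrow> nat \<Rightarrow> nat set" where
  "oriented m A f i = (if i \<in> f then items m - A i else A i)"

definition hard_valuation :: "nat \<Rightarrow> nat \<Rightarrow> nat \<Rightarrow> (nat \<Rightarrow> nat set) \<Rightarrow> nat set \<Rightarrow> valuation" where
  "hard_valuation m h N A f =
     restrict (\<lambda>S. real (cover_value h N (oriented m A f) (items m) S)) (Pow (items m))"

lemma hard_valuation_apply:
  "S \<subseteq> items m \<Longrightarrow>
    hard_valuation m h N A f S = real (cover_value h N (oriented m A f) (items m) S)"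
  by (simp add: hard_valuation_def)

context
  fixes m h N :: nat and A :: "nat \<Rightarrow> nat set"
  assumes A_sub: "\<And>i. A i \<subseteq> items m"
    and universal: "\<And>I J. I \<subseteq> {..<N} \<Longrightarrow> card I \<le> 3 * h \<Longrightarrow> \<exists>x\<in>items m. \<forall>i\<in>I. x \<in> A i \<longleftrightarrow> i \<in> J"
    and h: "3 \<le> h"
begin

text \<open>An item whose trace on \<open>I\<close> agrees with \<open>f\<close> lies in none of the
  oriented sets with index in \<open>I\<close>.\<close>

lemma oriented_uncovered:
  assumes "I \<subseteq> {..<N}" "items m \<subseteq> \<Union> (oriented m A f ` I)"
  shows "3 * h \<le> card I"
proof (rule ccontr)
  assume "\<not> 3 * h \<le> card I"
  then obtain x where "x \<in> items m" "\<forall>i\<in>I. x \<in> A i \<longleftrightarrow> i \<in> f"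
    using universal[OF assms(1), of f] by auto
  then show False using assms(2) by (auto simp: oriented_def split: if_splits)
qed

lemma universal_proper: "j < N \<Longrightarrow> A j \<subset> items m"
  using universal[of "{j}" "{}"] A_sub[of j] h by auto

lemma hard_valuation_in:
  assumes "2 * h \<le> 2 ^ k"
  shows "hard_valuation m h N A f \<in> subadditive_or_single_minded m k"
  unfolding hard_valuation_def
proof (rule integral_subadditive_in)
  show "cover_value h N (oriented m A f) (items m) {} = 0"
    by (rule cover_value_empty[OF oriented_uncovered])
  show "cover_value h N (oriented m A f) (items m) S \<le> 2 ^ k" for S
    using cover_value_le assms order_trans by blast
qed (auto intro: cover_value_mono cover_value_Un[OF oriented_uncovered] simp del: One_nat_def)

lemma hard_valuation_top: "hard_valuation m h N A f (items m) \<le> 2 * real h"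
  using cover_value_le[of h N "oriented m A f" "items m" "items m"]
  by (subst hard_valuation_apply) auto

lemma hard_valuation_disjoint:
  assumes "S \<subseteq> items m" "T \<subseteq> items m" "S \<inter> T = {}"
  shows "hard_valuation m h N A f S + hard_valuation m h N A f T \<le> 2 * real h"
  using cover_value_disjoint[OF assms(3,1,2), of h N "oriented m A f"] assms
  by (simp only: hard_valuation_apply)

lemma hard_valuation_low:
  assumes "j < N" "j \<notin> f"
  shows "hard_valuation m h N A f (A j) \<le> 1"
proof -
  have "cover_value h N (oriented m A f) (items m) (A j) \<le> card {j}"
    using assms h by (intro cover_value_covered[OF oriented_uncovered]) (auto simp: oriented_def)
  then show ?thesis using A_sub by (simp only: hard_valuation_apply) simp
qed

lemma hard_valuation_co_covered:
  assumes "I \<subseteq> {..<N}" "items m - S \<subseteq> \<Union> (oriented m A f ` I)" "card I < h" "S \<subseteq> items m"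
  shows "2 * real h - card I \<le> hard_valuation m h N A f S"
proof -
  have "2 * h \<le> cover_value h N (oriented m A f) (items m) S + card I"
    by (intro cover_value_co_covered[OF oriented_uncovered] assms)
  then show ?thesis unfolding hard_valuation_apply[OF assms(4)] by linarith
qed

lemma hard_valuation_high_aux:
  assumes "i < N" "i \<in> f" "i \<notin> g"
  shows "4 * real h - 2 \<le> hard_valuation m h N A f (A i) + hard_valuation m h N A g (items m - A i)"
proof -
  have "2 * real h - card {i} \<le> hard_valuation m h N A f (A i)"
    using assms h A_sub by (intro hard_valuation_co_covered) (auto simp: oriented_def)
  moreover have "2 * real h - card {i} \<le> hard_valuation m h N A g (items m - A i)"
    using assms h by (intro hard_valuation_co_covered) (auto simp: oriented_def)
  ultimately show ?thesis by simp
qed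

text \<open>The complement of each piece is covered by the two oriented sets for \<open>i\<close>
  and \<open>j\<close>, so each bidder loses at most \<open>2\<close>. The bound
  \<open>3 \<le> h\<close> keeps these two sets below the cap.\<close>

lemma hard_valuation_high_in_aux:
  assumes "i < N" "i \<in> f" "i \<notin> g" "j < N" "j \<in> f" "j \<in> g"
  shows "4 * real h - 4 \<le> hard_valuation m h N A f (A j \<inter> A i) + hard_valuation m h N A g (A j - A i)"
proof -
  have "2 * real h - card {i, j} \<le> hard_valuation m h N A f (A j \<inter> A i)"
    using assms h A_sub by (intro hard_valuation_co_covered) (auto simp: oriented_def card_insert_if)
  moreover have "2 * real h - card {i, j} \<le> hard_valuation m h N A g (A j - A i)"
    using assms h A_sub by (intro hard_valuation_co_covered) (auto simp: oriented_def card_insert_if)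
  moreover have "i \<noteq> j" using assms by blast
  ultimately show ?thesis by simp
qed

lemma differing_index:
  assumes "f \<subseteq> {..<N}" "g \<subseteq> {..<N}" "f \<noteq> g"
  obtains i where "i < N" "i \<in> f \<and> i \<notin> g \<or> i \<in> g \<and> i \<notin> f"
  using assms by blast

lemma hard_valuation_high:
  assumes "f \<subseteq> {..<N}" "g \<subseteq> {..<N}" "f \<noteq> g"
  shows "\<exists>X Y. X \<subseteq> items m \<and> Y \<subseteq> items m \<and> X \<inter> Y = {} \<and>
    4 * real h - 2 \<le> hard_valuation m h N A f X + hard_valuation m h N A g Y"
proof -
  obtain i where i: "i < N" "i \<in> f \<and> i \<notin> g \<or> i \<in> g \<and> i \<notin> f"
    using differing_index[OF assms] .
  from i(2) show ?thesis
  proof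
    assume "i \<in> f \<and> i \<notin> g"
    then show ?thesis
      using hard_valuation_high_aux[of i f g] i(1) A_sub[of i] by blast
  next
    assume "i \<in> g \<and> i \<notin> f"
    then show ?thesis
      using hard_valuation_high_aux[of i g f] i(1) A_sub[of i]
      by (intro exI[of _ "items m - A i"] exI[of _ "A i"]) auto
  qed
qed

lemma hard_valuation_high_in:
  assumes "j < N" "j \<in> f" "j \<in> g" "f \<subseteq> {..<N}" "g \<subseteq> {..<N}" "f \<noteq> g"
  shows "\<exists>X Y. X \<subseteq> A j \<and> Y \<subseteq> A j \<and> X \<inter> Y = {} \<and>
    4 * real h - 4 \<le> hard_valuation m h N A f X + hard_valuation m h N A g Y"
proof -
  obtain i where i: "i < N" "i \<in> f \<and> i \<notin> g \<or> i \<in> g \<and> i \<notin> f"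
    using differing_index[OF assms(4-6)] .
  from i(2) show ?thesis
  proof
    assume "i \<in> f \<and> i \<notin> g"
    then show ?thesis
      using hard_valuation_high_in_aux[of i f g j] i(1) assms(1-3)
      by (intro exI[of _ "A j \<inter> A i"] exI[of _ "A j - A i"]) auto
  next
    assume "i \<in> g \<and> i \<notin> f"
    then show ?thesis
      using hard_valuation_high_in_aux[of i g f j] i(1) assms(1-3)
      by (intro exI[of _ "A j - A i"] exI[of _ "A j \<inter> A i"]) (auto simp: add.commute)
  qed
qed

end

text \<open>\<open>(sqrt 3 - 1) / 2\<close> is the positive root of
  \<open>2 * x * (1 + x) = 1\<close>. With \<open>h\<close> about \<open>L / 12\<close>, the excess
  \<open>12 / L\<close> gains about \<open>4 * sqrt 3\<close> in the last inequality, enough for the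
  rounding terms \<open>9 * \<alpha> + 2 * \<alpha>\<^sup>2\<close>.\<close>

lemma low_bid_exists:
  fixes L \<alpha> :: real
  assumes "1200 \<le> L" and \<alpha>: "\<alpha> = (sqrt 3 - 1) / 2 + 12 / L" and h: "h = nat \<lfloor>L / 12\<rfloor>"
  obtains w where "w \<le> 4 * h" "2 \<le> w" "real w + 2 < \<alpha> * (4 * real h - 2)"
    "2 * real h < \<alpha> * (4 * real h - 6 + real w)"
proof -
  define \<delta> where "\<delta> = 12 / L"
  have \<delta>: "0 < \<delta>" "\<delta> \<le> 1 / 100" using assms(1) by (auto simp: \<delta>_def field_simps)
  have s: "17 / 10 < sqrt 3" "sqrt 3 < 174 / 100"
    by (rule real_less_rsqrt, simp add: power2_eq_square) (rule real_less_lsqrt, simp_all add: power2_eq_square)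
  have \<alpha>_eq: "\<alpha> = (sqrt 3 - 1) / 2 + \<delta>" by (simp add: \<alpha> \<delta>_def)
  have "100 \<le> h" using assms(1) unfolding h by linarith
  then have h_ge: "L / 12 - 1 \<le> real h" "100 \<le> real h"
    unfolding h by linarith+
  have \<alpha>_bds: "35 / 100 < \<alpha>" "\<alpha> < 38 / 100"
    using s \<delta> \<alpha>_eq by argo+
  have h\<delta>: "99 / 100 \<le> real h * \<delta>"
  proof -
    have "(L / 12 - 1) * \<delta> \<le> real h * \<delta>" using h_ge(1) \<delta>(1) by (intro mult_right_mono) auto
    moreover have "(L / 12 - 1) * \<delta> = 1 - \<delta>" using assms(1) by (simp add: \<delta>_def field_simps)
    ultimately show ?thesis using \<delta>(2) by linarith
  qed
  have "4 * real h * (\<alpha> + \<alpha>\<^sup>2) = 2 * real h + 4 * sqrt 3 * (real h * \<delta>) + 4 * real h * \<delta>\<^sup>2"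
    by (simp add: \<alpha>_eq power2_eq_square field_simps)
  moreover have "(17 / 10) * (99 / 100) \<le> sqrt 3 * (real h * \<delta>)"
    using s(1) h\<delta> by (intro mult_mono) auto
  moreover have "0 \<le> real h * \<delta>\<^sup>2" by simp
  moreover have "\<alpha>\<^sup>2 \<le> 1"
    using \<alpha>_bds by (simp add: power2_eq_square mult_le_one)
  ultimately have key: "2 * real h < 4 * real h * (\<alpha> + \<alpha>\<^sup>2) - 9 * \<alpha> - 2 * \<alpha>\<^sup>2"
    using \<alpha>_bds(2) by linarith
  \<comment> \<open>The largest integer strictly below
    \<open>\<alpha> * (4 * h - 2) - 2\<close>.\<close>
  define w where "w = nat (\<lceil>\<alpha> * (4 * real h - 2)\<rceil> - 3)"
  have lower: "(35 / 100) * 398 \<le> \<alpha> * (4 * real h - 2)"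
    using \<alpha>_bds(1) h_ge(2) by (intro mult_mono) auto
  have upper: "\<alpha> * (4 * real h - 2) \<le> 1 * (4 * real h - 2)"
    using \<alpha>_bds h_ge(2) by (intro mult_right_mono) auto
  have w: "real w < \<alpha> * (4 * real h - 2) - 2" "\<alpha> * (4 * real h - 2) - 3 \<le> real w"
    using lower unfolding w_def by linarith+
  have "\<alpha> * (4 * real h - 6 + (\<alpha> * (4 * real h - 2) - 3)) \<le> \<alpha> * (4 * real h - 6 + real w)"
    using w(2) \<alpha>_bds(1) by (intro mult_left_mono) auto
  moreover have "\<alpha> * (4 * real h - 6 + (\<alpha> * (4 * real h - 2) - 3))
      = 4 * real h * (\<alpha> + \<alpha>\<^sup>2) - 9 * \<alpha> - 2 * \<alpha>\<^sup>2"
    by (simp add: power2_eq_square algebra_simps)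
  ultimately have "2 * real h < \<alpha> * (4 * real h - 6 + real w)" using key by linarith
  moreover have "real w \<le> real (4 * h)" using w(1) upper by simp
  moreover have "2 \<le> real w" using w(2) lower by linarith
  ultimately show ?thesis using that[of w] w(1) by simp
qed

text \<open>As \<open>h\<close> is at most \<open>L / 12\<close>, the factor for the patterns is at
  most \<open>exp (sqrt m / 4)\<close>, while \<open>2 ^ (3 * h) \<le> sqrt m\<close> bounds the
  probability of missing one by \<open>exp (- sqrt m)\<close>.\<close>

lemma few_patterns:
  fixes L E :: real
  assumes "1 \<le> m" "L = log 2 (real m)" "0 < L" "E = exp (sqrt (real m) / L)"
    and "h \<le> L / 12" "2 * N \<le> E"
  shows "real (2 * N) ^ (3 * h) * (1 - 1 / 2 ^ (3 * h)) ^ m < 1"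
proof -
  have pow: "2 ^ (3 * h) \<le> sqrt (real m)"
  proof (rule real_le_rsqrt)
    have "(2 ^ (3 * h))\<^sup>2 = (2 :: real) ^ (6 * h)"
      by (simp flip: power_mult)
    also have "\<dots> = 2 powr real (6 * h)"
      by (rule powr_realpow[symmetric]) simp
    also have "\<dots> \<le> 2 powr L" using assms(5,3) by (intro powr_mono) auto
    also have "\<dots> = real m" using assms(1,2) by simp
    finally show "(2 ^ (3 * h))\<^sup>2 \<le> real m" .
  qed
  have "real (2 * N) ^ (3 * h) \<le> E ^ (3 * h)"
    using assms(6) by (intro power_mono) auto
  also have "\<dots> = exp (3 * h * (sqrt (real m) / L))"
    by (simp add: assms(4) flip: exp_of_nat_mult)
  also have "\<dots> \<le> exp (sqrt (real m) / 4)"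
  proof -
    have "3 * h * (sqrt (real m) / L) \<le> (L / 4) * (sqrt (real m) / L)"
      using assms(3,5) by (intro mult_right_mono) auto
    then show ?thesis using assms(3) by simp
  qed
  finally have 1: "real (2 * N) ^ (3 * h) \<le> exp (sqrt (real m) / 4)" .
  have "(1 - 1 / 2 ^ (3 * h)) ^ m \<le> exp (- (1 / 2 ^ (3 * h)) :: real) ^ m"
    using exp_ge_add_one_self[of "- (1 / 2 ^ (3 * h))"] by (intro power_mono) auto
  also have "\<dots> = exp (- (real m / 2 ^ (3 * h)))"
    by (simp flip: exp_of_nat_mult)
  also have "\<dots> \<le> exp (- sqrt (real m))"
  proof -
    have "sqrt (real m) * 2 ^ (3 * h) \<le> sqrt (real m) * sqrt (real m)"
      using pow by (intro mult_left_mono) auto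
    then show ?thesis by (simp add: field_simps)
  qed
  finally have "real (2 * N) ^ (3 * h) * (1 - 1 / 2 ^ (3 * h)) ^ m
      \<le> exp (sqrt (real m) / 4) * exp (- sqrt (real m))"
    using 1 by (intro mult_mono) auto
  also have "\<dots> = exp (- (3 / 4 * sqrt (real m)))" by (simp flip: exp_add)
  also have "\<dots> < 1" using assms(1) by simp
  finally show ?thesis .
qed

text \<open>The linear factor \<open>N + 1\<close> is absorbed by \<open>2 ^ Suc (N div 2)\<close>,
  about the square root of \<open>2 ^ N\<close>.\<close>

lemma many_leaves:
  assumes "3 * d + 4 + N div 2 \<le> N"
  shows "(N * 2 ^ Suc d + 1) * (2 ^ Suc d * 2 ^ Suc d) \<le> (2 :: nat) ^ N"
proof -
  have "N + 1 \<le> 2 * (N div 2 + 1)" by simp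
  also have "\<dots> \<le> 2 * 2 ^ (N div 2)"
    by (intro mult_le_mono2) (simp add: Suc_le_eq)
  finally have N: "N + 1 \<le> 2 ^ Suc (N div 2)" by simp
  have "N * 2 ^ Suc d + 1 \<le> (N + 1) * 2 ^ Suc d" by simp
  then have "(N * 2 ^ Suc d + 1) * (2 ^ Suc d * 2 ^ Suc d) \<le> ((N + 1) * 2 ^ Suc d) * (2 ^ Suc d * 2 ^ Suc d)"
    by (rule mult_right_mono) simp
  also have "\<dots> \<le> (2 ^ Suc (N div 2) * 2 ^ Suc d) * (2 ^ Suc d * 2 ^ Suc d)"
    using N by (intro mult_right_mono) auto
  also have "\<dots> = 2 ^ (3 * d + 4 + N div 2)"
    by (simp only: power_add[symmetric]) (rule arg_cong[of _ _ "(^) 2"], simp)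
  also have "\<dots> \<le> 2 ^ N" using assms by (intro power_increasing) auto
  finally show ?thesis .
qed

text \<open>A finite infimum \<open>d\<close> in \<open>enat\<close> lies below
  \<open>Suc d\<close>, so some protocol has cost at most \<open>d\<close>; an infinite one
  satisfies any bound.\<close>

lemma cc_lower_bound:
  assumes "\<And>d P. real d < b \<Longrightarrow> computes X P F \<Longrightarrow> \<forall>x\<in>X. length (transcript P x) \<le> d \<Longrightarrow> False"
  shows "ereal b \<le> ereal_of_enat (cc X F)"
proof (cases "cc X F")
  case (enat d)
  have "\<not> real d < b"
  proof
    assume less: "real d < b"
    have "cc X F < enat (Suc d)" using enat by simp
    then obtain P where P: "computes X P F" "cost X P < enat (Suc d)"
      by (auto simp: cc_def INF_less_iff)
    have "length (transcript P x) \<le> d" if "x \<in> X" for x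
    proof -
      have "enat (length (transcript P x)) \<le> cost X P"
        unfolding cost_def using that by (rule SUP_upper)
      then show ?thesis using P(2) by (metis enat_ord_simps(2) less_Suc_eq_le order_le_less_trans)
    qed
    then show False using assms[OF less P(1)] by blast
  qed
  then show ?thesis using enat by simp
qed simp

lemma approx_cc_lower_bound:
  fixes \<A> :: "3 auction" and L E :: real
  assumes L: "L = log 2 (real m)" "1200 \<le> L" "4 * L + 10 \<le> m"
    and E: "E = exp (sqrt (real m) / L)" "10000 \<le> E" "2 * L + 2 \<le> E"
    and \<A>: "\<A> \<in> auction_rules m (subadditive_or_single_minded m m)"
      "truthful (subadditive_or_single_minded m m) \<A>"
      "guarantees_approx m (subadditive_or_single_minded m m) ((sqrt 3 - 1) / 2 + 12 / L) \<A>"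
  shows "ereal (exp (1 / 2 * (sqrt (real m) / L)))
    \<le> ereal_of_enat (cc (profiles (subadditive_or_single_minded m m)) \<A>)"
proof (rule cc_lower_bound)
  fix d P
  let ?V = "subadditive_or_single_minded m m"
  assume d: "real d < exp (1 / 2 * (sqrt (real m) / L))"
    and P: "computes (profiles ?V) P \<A>" "\<forall>x\<in>profiles ?V. length (transcript P x) \<le> d"
  define \<alpha> where "\<alpha> = (sqrt 3 - 1) / 2 + 12 / L"
  define h where "h = nat \<lfloor>L / 12\<rfloor>"
  define N where "N = nat \<lfloor>E / 2\<rfloor>"
  have h: "real h \<le> L / 12" "100 \<le> h"
    using L(2) unfolding h_def by linarith+
  have N: "2 * real N \<le> E" "E / 2 - 1 \<le> real N"
    using E(2) unfolding N_def by linarith+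
  have "5 / 3 < sqrt (3 :: real)" by (rule real_less_rsqrt) (simp add: power2_eq_square)
  moreover have "0 < 12 / L" using L(2) by simp
  ultimately have \<alpha>: "1 / 3 < \<alpha>" unfolding \<alpha>_def by argo
  have m: "real (24 * h + 2) \<le> real m" using h(1) L(2,3) by simp
  have "m < 2 ^ m" by (rule less_exp)
  with m have pow: "24 * h + 2 \<le> 2 ^ m" by linarith
  have "3 * h \<le> N" using h(1) N(2) E(3) L(2) by linarith
  moreover have "real (2 * N) ^ (3 * h) * (1 - 1 / 2 ^ (3 * h)) ^ m < 1"
    using L E h N by (intro few_patterns) auto
  ultimately obtain A where A: "\<And>i. A i \<subseteq> items m"
    "\<And>I J. I \<subseteq> {..<N} \<Longrightarrow> card I \<le> 3 * h \<Longrightarrow> \<exists>x\<in>items m. \<forall>i\<in>I. x \<in> A i \<longleftrightarrow> i \<in> J"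
    by (rule universal_family) blast
  have h3: "3 \<le> h" using h(2) by simp
  obtain w where w: "w \<le> 4 * h" "2 \<le> w" "real w + 2 < \<alpha> * (4 * real h - 2)"
    "2 * real h < \<alpha> * (4 * real h - 6 + real w)"
    using low_bid_exists[OF L(2) \<alpha>_def h_def] .
  \<comment> \<open>The factor \<open>1 / 2\<close> in the exponent makes the bound on
    \<open>d\<close> equal to \<open>sqrt E\<close>, which is small compared with \<open>N\<close>,
    about \<open>E / 2\<close>.\<close>
  have "exp (1 / 2 * (sqrt (real m) / L)) = sqrt E"
    unfolding E(1) by (rule sym, rule real_sqrt_unique) (simp_all add: power2_eq_square flip: exp_add)
  moreover have "sqrt E \<le> E / 100"
    using E(2) by (intro real_le_lsqrt) (auto simp: power2_eq_square)
  ultimately have "real d \<le> E / 100" using d by linarith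
  then have "3 * d + 4 + N div 2 \<le> N" using N(2) E(2) by linarith
  then have large: "(N * 2 ^ Suc d + 1) * (2 ^ Suc d * 2 ^ Suc d) \<le> (2 :: nat) ^ N"
    by (rule many_leaves)
  \<comment> \<open>The large bid is \<open>W = 12 * h + 1\<close>, which suffices because
    \<open>\<alpha>\<close> exceeds \<open>1 / 3\<close>; twice this is the
    \<open>24 * h + 2\<close> bounded by \<open>2 ^ m\<close> above.\<close>
  have "4 * real h < 1 / 3 * real (12 * h + 1)" by simp
  also have "\<dots> < \<alpha> * real (12 * h + 1)"
    using \<alpha> by (intro mult_strict_right_mono) auto
  finally have W: "4 * real h < \<alpha> * real (12 * h + 1)" .
  interpret approx_auction m m \<A> \<alpha>
    using \<A>(1,2) \<A>(3)[folded \<alpha>_def] \<alpha> by unfold_locales auto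
  show False
    by (rule no_cheap_protocol[where \<phi> = "hard_valuation m h N A" and D = A and w = w,
          OF P(1) P(2)[rule_format] hard_valuation_in[OF A h3] hard_valuation_top[OF A h3]
            hard_valuation_disjoint[OF A h3] universal_proper[OF A h3] hard_valuation_low[OF A h3]
            hard_valuation_high[OF A h3] hard_valuation_high_in[OF A h3] W _ _ w(2-4) large])
      (use pow w(1) in auto)
qed

theorem theorem4p1:
  "\<exists>c>0. \<exists>m\<^sub>0. \<exists>k :: nat \<Rightarrow> nat.
     (\<exists>d::nat. (\<lambda>m. real (k m)) \<in> O(\<lambda>m. real m ^ d)) \<and>
     (\<forall>m\<ge>m\<^sub>0. let V = subadditive_or_single_minded m (k m) in
        \<forall>\<A> :: 3 auction.
          \<A> \<in> auction_rules m V \<longrightarrow> truthful V \<A> \<longrightarrow>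
          guarantees_approx m V ((sqrt 3 - 1) / 2 + 12 / log 2 (real m)) \<A> \<longrightarrow>
          ereal_of_enat (cc (profiles V) \<A>) \<ge> ereal (exp (c * (sqrt (real m) / log 2 (real m)))))"
proof -
  have "\<forall>\<^sub>F m::nat in sequentially. 1200 \<le> log 2 (real m)"
    "\<forall>\<^sub>F m::nat in sequentially. 4 * log 2 (real m) + 10 \<le> real m"
    "\<forall>\<^sub>F m::nat in sequentially. 10000 \<le> exp (sqrt (real m) / log 2 (real m))"
    "\<forall>\<^sub>F m::nat in sequentially. 2 * log 2 (real m) + 2 \<le> exp (sqrt (real m) / log 2 (real m))"
    by real_asymp+
  then have "\<forall>\<^sub>F m::nat in sequentially. 1200 \<le> log 2 (real m) \<and> 4 * log 2 (real m) + 10 \<le> real m \<and>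
      10000 \<le> exp (sqrt (real m) / log 2 (real m)) \<and>
      2 * log 2 (real m) + 2 \<le> exp (sqrt (real m) / log 2 (real m))"
    by eventually_elim simp
  then obtain m\<^sub>0 where m\<^sub>0: "\<And>m. m \<ge> m\<^sub>0 \<Longrightarrow> 1200 \<le> log 2 (real m) \<and>
      4 * log 2 (real m) + 10 \<le> real m \<and> 10000 \<le> exp (sqrt (real m) / log 2 (real m)) \<and>
      2 * log 2 (real m) + 2 \<le> exp (sqrt (real m) / log 2 (real m))"
    unfolding eventually_sequentially by blast
  show ?thesis
  proof (rule exI[of _ "1 / 2"], rule conjI, simp, rule exI[of _ m\<^sub>0], rule exI[of _ "\<lambda>m. m"],
      rule conjI)
    show "\<exists>d. real \<in> O(\<lambda>m. real m ^ d)"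
      by (rule exI[of _ 1]) simp
    show "\<forall>m\<ge>m\<^sub>0. let V = subadditive_or_single_minded m m in
        \<forall>\<A> :: 3 auction.
          \<A> \<in> auction_rules m V \<longrightarrow> truthful V \<A> \<longrightarrow>
          guarantees_approx m V ((sqrt 3 - 1) / 2 + 12 / log 2 (real m)) \<A> \<longrightarrow>
          ereal_of_enat (cc (profiles V) \<A>) \<ge> ereal (exp (1 / 2 * (sqrt (real m) / log 2 (real m))))"
      unfolding Let_def using m\<^sub>0 by (intro allI impI approx_cc_lower_bound) auto
  qed
qed

end
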